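(* Let $A$ be a finite abelian group with $|A|\ge 3$, let $f$ be an automorphism of $A$ of order $2$, let $y\in A$ satisfy $f(y)=y$, let $G=\langle A, x \mid x^2=y,\ xax^{-1}=f(a)\ (a\in A)\rangle$, and let $B=\{f(a)a^{-1}: a\in A\}$, with index $(A:B)$ in $A$. Then $G$ has exactly $2(A:B)+(|A|-(A:B))/2$ pairwise inequivalent irreducible representations $\rho_1,\dots,\rho_{2(A:B)+(|A|-(A:B))/2}$, and they can be taken as follows. (1) Let $\pi_1,\dots,\pi_{(A:B)}$ be the pairwise inequivalent irreducible representations of $A/B$. For $j\in\{1,\dots,(A:B)\}$, $\rho_j$ and $\rho_{j+(A:B)}$ are the one-dimensional representations of $G$ given by $\rho_j(x)=\sqrt{\pi_j(\overline{y})}$, $\rho_j(a)=\pi_j(\overline{a})$ for $a\in A$, and $\rho_{j+(A:B)}(x)=-\sqrt{\pi_j(\overline{y})}$, $\rho_{j+(A:B)}(a)=\pi_j(\overline{a})$ for $a\in A$, where $\overline{a}$ denotes the class of $a\in A$ modulo $B$ and $\sqrt{\pi_j(\overline{y})}$ is a fixed square root of $\pi_j(\overline{y})$ in $\mathbb{C}$. (2) Let $\psi_1,\dots,\psi_{|A|-(A:B)}$ be the pairwise inequivalent irreducible representations of $A$ whose kernels do not contain $B$, indexed so that $\psi_{j+(|A|-(A:B))/2}=\psi_j\circ f$ for $j\in\{1,\dots,(|A|-(A:B))/2\}$. Then for $j\in\{1,\dots,(|A|-(A:B))/2\}$ and $a\in A$, $\rho_{2(A:B)+j}(a)=\begin{pmatrix}\psi_j(a)&0\\0&\psi_j(f(a))\end{pmatrix}$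 and $\rho_{2(A:B)+j}(xa)=\begin{pmatrix}0&\psi_j(yf(a))\\ \psi_j(a)&0\end{pmatrix}$.
   Context: The presentation means $G$ is generated by $A$ and an element $x$ subject to the relations of $A$ together with $x^2=y$ and $xax^{-1}=f(a)$ for all $a\in A$; $G$ is the disjoint union of $A$ and $xA$, and $|G|=2|A|$. Representations are complex representations; irreducible representations of an abelian group are one-dimensional. *)

theory Defs
  imports
    "HOL-Algebra.Bij"
    "HOL-Algebra.Multiplicative_Group"
    "Jordan_Normal_Form.VS_Connect"
begin

section \<open>Groups given by generators and relators\<close>

text \<open>A letter \<open>(s, True)\<close> stands for the generator \<open>s\<close>, and \<open>(s, False)\<close> for its inverse.\<close>

type_synonym 's gword = "('s \<times> bool) list"

definition gwords :: "'s set \<Rightarrow> 's gword set" where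
  "gwords S = lists (S \<times> UNIV)"

text \<open>The least congruence on words that makes \<open>s s\<inverse>\<close>, \<open>s\<inverse> s\<close> and all
  relators trivial: the classes are the elements of the free group on \<open>S\<close> modulo the normal
  closure of \<open>R\<close>.\<close>

inductive_set pres_rel :: "'s set \<Rightarrow> 's gword set \<Rightarrow> ('s gword \<times> 's gword) set"
  for S :: "'s set" and R :: "'s gword set" where
  pres_refl: "w \<in> gwords S \<Longrightarrow> (w, w) \<in> pres_rel S R"
| pres_sym: "(v, w) \<in> pres_rel S R \<Longrightarrow> (w, v) \<in> pres_rel S R"
| pres_trans: "(u, v) \<in> pres_rel S R \<Longrightarrow> (v, w) \<in> pres_rel S R \<Longrightarrow> (u, w) \<in> pres_rel S R"
| pres_cancel: "u \<in> gwords S \<Longrightarrow> v \<in> gwords S \<Longrightarrow> s \<in> S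
    \<Longrightarrow> (u @ [(s, b), (s, \<not> b)] @ v, u @ v) \<in> pres_rel S R"
| pres_relator: "u \<in> gwords S \<Longrightarrow> v \<in> gwords S \<Longrightarrow> r \<in> R \<Longrightarrow> r \<in> gwords S
    \<Longrightarrow> (u @ r @ v, u @ v) \<in> pres_rel S R"

definition pres_group :: "'s set \<Rightarrow> 's gword set \<Rightarrow> 's gword set monoid" where
  "pres_group S R =
     \<lparr>carrier = gwords S // pres_rel S R,
      mult = (\<lambda>U V. \<Union>u\<in>U. \<Union>v\<in>V. pres_rel S R `` {u @ v}),
      one = pres_rel S R `` {[]}\<rparr>"

definition pres_gen :: "'s set \<Rightarrow> 's gword set \<Rightarrow> 's \<Rightarrow> 's gword set" where
  "pres_gen S R s = pres_rel S R `` {[(s, True)]}"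

lemma equiv_pres_rel: "equiv (gwords S) (pres_rel S R)"
proof -
  have "v \<in> gwords S \<and> w \<in> gwords S" if "(v, w) \<in> pres_rel S R" for v w
    using that by induction (auto simp: gwords_def)
  then show ?thesis
    by (auto intro!: equivI refl_onI symI transI intro: pres_refl pres_sym pres_trans)
qed

lemma pres_rel_context:
  assumes "(v, w) \<in> pres_rel S R" "p \<in> gwords S" "q \<in> gwords S"
  shows "(p @ v @ q, p @ w @ q) \<in> pres_rel S R"
  using assms
proof induction
  case (pres_refl w)
  then show ?case by (auto intro!: pres_rel.pres_refl simp: gwords_def)
next
  case (pres_sym v w)
  then show ?case by (auto intro: pres_rel.pres_sym)
next
  case (pres_trans u v w)
  then show ?case by (auto intro: pres_rel.pres_trans)
next
  case (pres_cancel u v s b)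
  then show ?case
    using pres_rel.pres_cancel[of "p @ u" S "v @ q" s b R] by (auto simp: gwords_def)
next
  case (pres_relator u v r)
  then show ?case
    using pres_rel.pres_relator[of "p @ u" S "v @ q" r R] by (auto simp: gwords_def)
qed

lemma pres_group_mult:
  assumes "u \<in> gwords S" "v \<in> gwords S"
  shows "pres_rel S R `` {u} \<otimes>\<^bsub>pres_group S R\<^esub> pres_rel S R `` {v} = pres_rel S R `` {u @ v}"
proof -
  have "congruent2 (pres_rel S R) (pres_rel S R) (\<lambda>u v. pres_rel S R `` {u @ v})"
  proof (rule congruent2I[OF equiv_pres_rel equiv_pres_rel])
    fix y z w assume 1: "w \<in> gwords S" "(y, z) \<in> pres_rel S R"
    show "pres_rel S R `` {y @ w} = pres_rel S R `` {z @ w}"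
      using pres_rel_context[OF 1(2), of "[]" w] 1
      by (intro equiv_class_eq[OF equiv_pres_rel]) (auto simp: gwords_def)
    show "pres_rel S R `` {w @ y} = pres_rel S R `` {w @ z}"
      using pres_rel_context[OF 1(2), of w "[]"] 1
      by (intro equiv_class_eq[OF equiv_pres_rel]) (auto simp: gwords_def)
  qed
  from UN_equiv_class2[OF equiv_pres_rel equiv_pres_rel this assms]
  show ?thesis by (simp add: pres_group_def)
qed

lemma group_pres_group: "group (pres_group S R)"
proof -
  let ?C = "\<lambda>w. pres_rel S R `` {w}"
  have car: "carrier (pres_group S R) = ?C ` gwords S"
    by (auto simp: pres_group_def quotient_def)
  have one: "\<one>\<^bsub>pres_group S R\<^esub> = ?C []" by (simp add: pres_group_def)
  have [simp]: "[] \<in> gwords S" by (simp add: gwords_def)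
  have app [simp]: "u @ v \<in> gwords S" if "u \<in> gwords S" "v \<in> gwords S" for u v
    using that by (auto simp: gwords_def)
  have inv: "\<exists>v\<in>gwords S. ?C (v @ w) = ?C []" if "w \<in> gwords S" for w
    using that
  proof (induction w)
    case Nil
    then show ?case by (intro bexI[of _ "[]"]) auto
  next
    case (Cons l w)
    obtain s b where l: "l = (s, b)" by (cases l)
    from Cons.prems l have s: "s \<in> S" and w: "w \<in> gwords S" by (auto simp: gwords_def)
    from Cons.IH[OF w] obtain v where v: "v \<in> gwords S" "?C (v @ w) = ?C []" by blast
    have "(v @ [(s, \<not> b), (s, \<not> \<not> b)] @ w, v @ w) \<in> pres_rel S R"
      by (rule pres_cancel[OF v(1) w s])
    then have "?C ((v @ [(s, \<not> b)]) @ l # w) = ?C (v @ w)"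
      using l by (intro equiv_class_eq[OF equiv_pres_rel]) simp
    moreover have "v @ [(s, \<not> b)] \<in> gwords S" using v s by (auto simp: gwords_def)
    ultimately show ?case using v(2) by blast
  qed
  show ?thesis
  proof (rule groupI)
    fix x assume "x \<in> carrier (pres_group S R)"
    then obtain w where w: "w \<in> gwords S" "x = ?C w" by (auto simp: car)
    from inv[OF w(1)] obtain v where "v \<in> gwords S" "?C (v @ w) = ?C []" by blast
    then show "\<exists>y\<in>carrier (pres_group S R). y \<otimes>\<^bsub>pres_group S R\<^esub> x = \<one>\<^bsub>pres_group S R\<^esub>"
      using w by (intro bexI[of _ "?C v"]) (auto simp: car one pres_group_mult)
  qed (auto simp: car one pres_group_mult)
qed

section \<open>The extension of an abelian group by one generator\<close>

datatype 'a ext_letter = Base 'a | Ext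

text \<open>The first set is the multiplication table of \<open>A\<close>; the others encode
  \<open>x\<^sup>2 = y\<close> and \<open>x a x\<inverse> = f a\<close>.\<close>

definition ext_relators ::
  "('a, 'm) monoid_scheme \<Rightarrow> ('a \<Rightarrow> 'a) \<Rightarrow> 'a \<Rightarrow> 'a ext_letter gword set" where
  "ext_relators A f y =
     {[(Base a, True), (Base b, True), (Base (a \<otimes>\<^bsub>A\<^esub> b), False)] | a b.
        a \<in> carrier A \<and> b \<in> carrier A}
   \<union> {[(Ext, True), (Ext, True), (Base y, False)]}
   \<union> {[(Ext, True), (Base a, True), (Ext, False), (Base (f a), False)] | a. a \<in> carrier A}"

definition ext_letters :: "('a, 'm) monoid_scheme \<Rightarrow> 'a ext_letter set" where
  "ext_letters A = insert Ext (Base ` carrier A)"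

definition ext_group ::
  "('a, 'm) monoid_scheme \<Rightarrow> ('a \<Rightarrow> 'a) \<Rightarrow> 'a \<Rightarrow> 'a ext_letter gword set monoid" where
  "ext_group A f y = pres_group (ext_letters A) (ext_relators A f y)"

definition ext_base ::
  "('a, 'm) monoid_scheme \<Rightarrow> ('a \<Rightarrow> 'a) \<Rightarrow> 'a \<Rightarrow> 'a \<Rightarrow> 'a ext_letter gword set" where
  "ext_base A f y a = pres_gen (ext_letters A) (ext_relators A f y) (Base a)"

definition ext_elem ::
  "('a, 'm) monoid_scheme \<Rightarrow> ('a \<Rightarrow> 'a) \<Rightarrow> 'a \<Rightarrow> 'a ext_letter gword set" where
  "ext_elem A f y = pres_gen (ext_letters A) (ext_relators A f y) Ext"

section \<open>Complex matrix representations\<close>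

definition GLC :: "nat \<Rightarrow> complex mat monoid" where
  "GLC n = units_of (ring_mat TYPE(complex) n ())"

definition is_rep :: "('g, 'm) monoid_scheme \<Rightarrow> nat \<Rightarrow> ('g \<Rightarrow> complex mat) \<Rightarrow> bool" where
  "is_rep G n \<rho> \<longleftrightarrow> \<rho> \<in> hom G (GLC n)"

definition is_irrep :: "('g, 'm) monoid_scheme \<Rightarrow> nat \<Rightarrow> ('g \<Rightarrow> complex mat) \<Rightarrow> bool" where
  "is_irrep G n \<rho> \<longleftrightarrow> is_rep G n \<rho> \<and> n > 0 \<and>
     (\<forall>W. VectorSpace.subspace class_ring W (module_vec TYPE(complex) n) \<longrightarrow>
          (\<forall>g\<in>carrier G. \<forall>w\<in>W. \<rho> g *\<^sub>v w \<in> W) \<longrightarrow>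
          W = {0\<^sub>v n} \<or> W = carrier_vec n)"

definition irreps :: "('g, 'm) monoid_scheme \<Rightarrow> ('g \<Rightarrow> complex mat) set" where
  "irreps G = {\<rho>. \<exists>n. is_irrep G n \<rho>}"

definition equiv_rep ::
  "('g, 'm) monoid_scheme \<Rightarrow> ('g \<Rightarrow> complex mat) \<Rightarrow> ('g \<Rightarrow> complex mat) \<Rightarrow> bool" where
  "equiv_rep G \<rho> \<sigma> \<longleftrightarrow>
     (\<exists>n. is_rep G n \<rho> \<and> is_rep G n \<sigma> \<and>
        (\<exists>P\<in>carrier (GLC n). \<forall>g\<in>carrier G. P * \<rho> g = \<sigma> g * P))"

text \<open>\<open>\<rho> 1, \<dots>, \<rho> N\<close> are, up to equivalence and without repetition, all the
  representations of \<open>G\<close> that belong to \<open>C\<close>.\<close>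

definition enumerates_reps ::
  "('g, 'm) monoid_scheme \<Rightarrow> ('g \<Rightarrow> complex mat) set \<Rightarrow> nat
     \<Rightarrow> (nat \<Rightarrow> 'g \<Rightarrow> complex mat) \<Rightarrow> bool" where
  "enumerates_reps G C N \<rho> \<longleftrightarrow>
     (\<forall>j\<in>{1..N}. \<rho> j \<in> C) \<and>
     (\<forall>i\<in>{1..N}. \<forall>j\<in>{1..N}. i \<noteq> j \<longrightarrow> \<not> equiv_rep G (\<rho> i) (\<rho> j)) \<and>
     (\<forall>\<sigma>\<in>C. \<exists>j\<in>{1..N}. equiv_rep G \<sigma> (\<rho> j))"

definition irreps_ker_not_containing ::
  "('g, 'm) monoid_scheme \<Rightarrow> 'g set \<Rightarrow> ('g \<Rightarrow> complex mat) set" where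
  "irreps_ker_not_containing G B =
     {\<sigma>. \<exists>n. is_irrep G n \<sigma> \<and> \<not> B \<subseteq> kernel G (GLC n) \<sigma>}"

text \<open>One-dimensional representations take values in 1 by 1 matrices; these two functions pass
  between such matrices and scalars.\<close>

definition mat1 :: "complex \<Rightarrow> complex mat" where
  "mat1 c = mat_of_rows_list 1 [[c]]"

definition entry1 :: "complex mat \<Rightarrow> complex" where
  "entry1 M = M $$ (0, 0)"

end

theory Submission
  imports Defs
begin

text \<open>Restrict an irreducible representation of \<open>G\<close> to \<open>A\<close> and pick a common eigenvector \<open>v\<close>,
  with character \<open>\<chi>\<close>.  Then \<open>x v\<close> is an eigenvector with character \<open>\<chi> \<circ> f\<close>, and
  \<open>\<chi> \<circ> f = \<chi>\<close> holds iff \<open>\<chi>\<close> is trivial on \<open>B\<close>.  If \<open>\<chi> \<circ> f = \<chi>\<close> and \<open>t\<^sup>2 = \<chi> y\<close>, either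
  \<open>x v + t v\<close> or \<open>v\<close> spans an invariant line, on which \<open>x\<close> acts as \<open>t\<close> or \<open>- t\<close>; otherwise
  \<open>v\<close> and \<open>x v\<close> span a copy of the two-dimensional representation attached to \<open>\<chi>\<close>.  Schur's
  lemma turns these into equivalences.  The numbers come from \<open>A\<close> having \<open>|A|\<close> characters, of
  which \<open>(A:B)\<close> are trivial on \<open>B\<close>; on the others \<open>\<chi> \<mapsto> \<chi> \<circ> f\<close> is an involution without
  fixed points.\<close>

section \<open>Characters of finite abelian groups\<close>

text \<open>\<open>G\<close> is known only through its presentation. Two facts give access to it:
  matrices satisfying the relators extend to a representation, and every element is
  \<open>\<iota> a\<close> or \<open>x\<close> times \<open>\<iota> a\<close>, so intertwining need
  only be checked on \<open>A\<close> and on \<open>x\<close>. The two-dimensional matrices are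
  those of \<open>A\<close> and \<open>x\<close> on the basis \<open>v\<close>, \<open>x v\<close>,
  since \<open>x\<close> sends \<open>x v\<close> to \<open>\<chi> y\<close> times \<open>v\<close>.
  The vector \<open>x v + t v\<close> works because (x - t)(x + t) v = (x^2 - t^2) v = 0; the
  choices \<open>t\<close> and \<open>- t\<close> remain inequivalent because
  \<open>\<chi> y\<close> is nonzero. The dimension of an irreducible representation is unknown
  beforehand, so the vectors found in it become the columns of a rectangular intertwiner, and
  Schur's lemma returns the dimension along with the equivalence. The count of characters rests on
  the two orthogonality relations, one of which needs characters to separate the points of
  \<open>A\<close>; this is obtained by Fourier decomposition of functions on \<open>A\<close>, one
  cyclic subgroup at a time.\<close>

definition is_char :: "('g, 'm) monoid_scheme \<Rightarrow> ('g \<Rightarrow> complex) \<Rightarrow> bool" where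
  "is_char H \<chi> \<longleftrightarrow> \<chi> \<one>\<^bsub>H\<^esub> = 1 \<and>
     (\<forall>a\<in>carrier H. \<forall>b\<in>carrier H. \<chi> (a \<otimes>\<^bsub>H\<^esub> b) = \<chi> a * \<chi> b)"

text \<open>Extensionality makes two characters equal once they agree on the carrier, so that
  characters can be counted; \<open>is_char\<close> leaves the values elsewhere free and so passes
  directly to composites such as \<open>\<chi> \<circ> f\<close>.\<close>

definition chars :: "('g, 'm) monoid_scheme \<Rightarrow> ('g \<Rightarrow> complex) set" where
  "chars H = {\<chi> \<in> extensional (carrier H). is_char H \<chi>}"

lemma is_char_one: "is_char H \<chi> \<Longrightarrow> \<chi> \<one>\<^bsub>H\<^esub> = 1"
  by (simp add: is_char_def)

lemma is_char_mult:
  "is_char H \<chi> \<Longrightarrow> a \<in> carrier H \<Longrightarrow> b \<in> carrier H \<Longrightarrow> \<chi> (a \<otimes>\<^bsub>H\<^esub> b) = \<chi> a * \<chi> b"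
  by (simp add: is_char_def)

lemma (in group) is_char_inv_mult:
  assumes "is_char G \<chi>" "a \<in> carrier G"
  shows "\<chi> (inv a) * \<chi> a = 1"
  using is_char_mult[OF assms(1), of "inv a" a] is_char_one[OF assms(1)] assms(2) by simp

lemma (in group) is_char_nonzero: "is_char G \<chi> \<Longrightarrow> a \<in> carrier G \<Longrightarrow> \<chi> a \<noteq> 0"
  using is_char_inv_mult[of \<chi> a] by auto

lemma (in group) is_char_inv:
  "is_char G \<chi> \<Longrightarrow> a \<in> carrier G \<Longrightarrow> \<chi> (inv a) = inverse (\<chi> a)"
  using is_char_inv_mult[of \<chi> a] by (metis inverse_unique mult.commute)

lemma (in group) is_char_pow:
  assumes "is_char G \<chi>" "a \<in> carrier G"
  shows "\<chi> (a [^] (n::nat)) = \<chi> a ^ n"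
  using assms by (induction n) (simp_all add: is_char_one is_char_mult)

lemma (in monoid) is_char_restrict:
  "is_char G \<chi> \<Longrightarrow> restrict \<chi> (carrier G) \<in> chars G"
  by (simp add: chars_def is_char_def)

lemma (in group) finite_chars:
  assumes "finite (carrier G)"
  shows "finite (chars G)"
proof (rule finite_subset)
  have pos: "Coset.order G > 0" using assms by (simp add: order_gt_0_iff_finite)
  show "chars G \<subseteq> carrier G \<rightarrow>\<^sub>E {z. z ^ Coset.order G = 1}"
  proof (intro subsetI PiE_I)
    fix \<chi> a assume *: "\<chi> \<in> chars G" "a \<in> carrier G"
    then show "\<chi> a \<in> {z. z ^ Coset.order G = 1}"
      using is_char_pow[of \<chi> a "Coset.order G"] pow_order_eq_1[of a]
      by (simp add: chars_def is_char_one)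
  qed (auto simp: chars_def extensional_def)
  show "finite (carrier G \<rightarrow>\<^sub>E {z::complex. z ^ Coset.order G = 1})"
    using assms pos by (intro finite_PiE finite_roots_unity) auto
qed

text \<open>Geometric series with ratio \<open>?c\<close>, an \<open>N\<close>-th root of unity that
  differs from 1 for 0 < i < N because the \<open>N\<close> roots are pairwise distinct.\<close>

lemma sum_cis_powers:
  assumes "i < N"
  shows "(\<Sum>k<N. cis (2 * pi * real k / real N) ^ i) = (if i = 0 then of_nat N else 0)"
proof (cases "i = 0")
  case False
  let ?c = "cis (2 * pi * real i / real N)"
  have "?c \<noteq> 1"
  proof
    assume "?c = 1"
    then have "cis (2 * pi * real i / real N) = cis (2 * pi * real 0 / real N)" by simp
    then have "i = 0"
      using bij_betw_imp_inj_on[OF bij_betw_roots_unity[of N]] assms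
      by (auto simp: inj_on_def)
    with False show False by simp
  qed
  moreover have "?c ^ N = 1"
    using assms by (simp add: DeMoivre cis_multiple_2pi)
  moreover have "cis (2 * pi * real k / real N) ^ i = ?c ^ k" for k
    by (simp add: DeMoivre mult_ac)
  ultimately show ?thesis
    using False by (simp add: sum_gp_strict)
qed simp

text \<open>The translation operators on functions commute and have finite order, so a common
  eigenfunction is obtained by projecting onto one eigenspace after the other.  A common
  eigenfunction is a multiple of a character.\<close>

definition (in monoid) shift_proj :: "'a \<Rightarrow> complex \<Rightarrow> ('a \<Rightarrow> complex) \<Rightarrow> 'a \<Rightarrow> complex" where
  "shift_proj c \<mu> F b = (\<Sum>i<Coset.order G. \<mu> ^ i * F (c [^] i \<otimes> b))"

text \<open>Translation by \<open>c\<close> moves the summation index by one, and the sum is cyclic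
  because \<open>\<mu>\<close> and \<open>c\<close> both become trivial at the power
  \<open>Coset.order G\<close>. The weights are powers of \<open>\<mu>\<close>, so the eigenvalue is
  its inverse.\<close>

lemma (in group) shift_proj_eigen:
  assumes "finite (carrier G)" "c \<in> carrier G" "b \<in> carrier G" "\<mu> ^ Coset.order G = 1"
  shows "shift_proj c \<mu> F (c \<otimes> b) = inverse \<mu> * shift_proj c \<mu> F b"
proof -
  let ?N = "Coset.order G"
  let ?g = "\<lambda>i. \<mu> ^ i * F (c [^] i \<otimes> b)"
  have N: "?N > 0" using assms(1) by (simp add: order_gt_0_iff_finite)
  have \<mu>: "\<mu> \<noteq> 0" using assms(4) N by (auto simp: power_0_left)
  \<comment> \<open>Both sides are the sum of \<open>g\<close> over 0..n; once the end terms agree,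
    this is the cyclic shift.\<close>
  have "(\<Sum>i<n. g (Suc i)) + g 0 = (\<Sum>i<n. g i) + g n" for g :: "nat \<Rightarrow> complex" and n
    by (induction n) (simp_all add: algebra_simps)
  from this[of ?g ?N] have "(\<Sum>i<?N. ?g (Suc i)) + ?g 0 = (\<Sum>i<?N. ?g i) + ?g ?N" .
  moreover have "?g ?N = ?g 0"
    using assms pow_order_eq_1[of c] by simp
  ultimately have "(\<Sum>i<?N. ?g (Suc i)) = shift_proj c \<mu> F b"
    by (simp add: shift_proj_def)
  moreover have "c [^] i \<otimes> (c \<otimes> b) = c [^] Suc i \<otimes> b" for i :: nat
    using assms by (simp add: m_assoc)
  then have "\<mu> * shift_proj c \<mu> F (c \<otimes> b) = (\<Sum>i<?N. ?g (Suc i))"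
    by (simp add: shift_proj_def sum_distrib_left mult.assoc)
  ultimately show ?thesis using \<mu> by (simp add: field_simps)
qed

text \<open>Summing over all \<open>\<mu>\<close> kills every translate except \<open>i = 0\<close>.
  Hence \<open>F\<close> is, up to a factor, the sum of its eigencomponents, and a nonzero value of
  \<open>F\<close> forces a nonzero component.\<close>

lemma (in group) sum_shift_proj:
  assumes "finite (carrier G)" "c \<in> carrier G" "b \<in> carrier G"
  shows "(\<Sum>k<Coset.order G. shift_proj c (cis (2 * pi * real k / real (Coset.order G))) F b)
    = of_nat (Coset.order G) * F b"
proof -
  let ?N = "Coset.order G"
  have N: "?N > 0" using assms(1) by (simp add: order_gt_0_iff_finite)
  have "(\<Sum>k<?N. shift_proj c (cis (2 * pi * real k / real ?N)) F b)
      = (\<Sum>i<?N. (\<Sum>k<?N. cis (2 * pi * real k / real ?N) ^ i) * F (c [^] i \<otimes> b))"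
    unfolding shift_proj_def by (subst sum.swap) (simp add: sum_distrib_right)
  also have "\<dots> = (\<Sum>i<?N. if i = 0 then of_nat ?N * F b else 0)"
    using assms by (intro sum.cong) (auto simp: sum_cis_powers simp del: of_nat_mult)
  also have "\<dots> = of_nat ?N * F b" using N by simp
  finally show ?thesis .
qed

text \<open>Commutativity enters here: a further projection keeps the eigenvalues already
  secured.\<close>

lemma (in comm_group) shift_proj_commute:
  assumes "c \<in> carrier G" "d \<in> carrier G" "b \<in> carrier G"
    and "\<And>b. b \<in> carrier G \<Longrightarrow> F (d \<otimes> b) = \<nu> * F b"
  shows "shift_proj c \<mu> F (d \<otimes> b) = \<nu> * shift_proj c \<mu> F b"
proof -
  have "F (c [^] i \<otimes> (d \<otimes> b)) = \<nu> * F (c [^] i \<otimes> b)" for i :: nat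
    using assms by (metis m_lcomm nat_pow_closed m_closed)
  then show ?thesis
    by (simp add: shift_proj_def sum_distrib_left mult_ac)
qed

text \<open>The induction preserves the eigenvalue \<open>\<nu>\<close> at the one element
  \<open>a\<close>; this is how a character with a prescribed value at \<open>a\<close>
  arises.\<close>

lemma (in comm_group) common_eigenfunction:
  fixes F :: "'a \<Rightarrow> complex"
  assumes "finite (carrier G)" "finite S" "S \<subseteq> carrier G"
    and "a \<in> carrier G" "\<And>b. b \<in> carrier G \<Longrightarrow> F (a \<otimes> b) = \<nu> * F b"
    and "b \<in> carrier G" "F b \<noteq> 0"
  shows "\<exists>F' :: 'a \<Rightarrow> complex. (\<forall>b\<in>carrier G. F' (a \<otimes> b) = \<nu> * F' b) \<and> (\<exists>b\<in>carrier G. F' b \<noteq> 0) \<and>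
    (\<forall>d\<in>S. \<exists>\<kappa>. \<forall>b\<in>carrier G. F' (d \<otimes> b) = \<kappa> * F' b)"
  using assms(2,3)
proof (induction S rule: finite_induct)
  case empty
  then show ?case using assms by blast
next
  case (insert c S)
  let ?N = "Coset.order G"
  let ?\<mu> = "\<lambda>k. cis (2 * pi * real k / real ?N)"
  have N: "?N > 0" using assms(1) by (simp add: order_gt_0_iff_finite)
  from insert obtain F' b where F': "\<forall>b\<in>carrier G. F' (a \<otimes> b) = \<nu> * F' b"
    and b: "b \<in> carrier G" "F' b \<noteq> 0"
    and S: "\<forall>d\<in>S. \<exists>\<kappa>. \<forall>b\<in>carrier G. F' (d \<otimes> b) = \<kappa> * F' b" by blast
  have c: "c \<in> carrier G" using insert by blast
  have "(\<Sum>k<?N. shift_proj c (?\<mu> k) F' b) \<noteq> 0"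
    using sum_shift_proj[OF assms(1) c b(1), of F'] b(2) N by simp
  then obtain k where k: "k < ?N" "shift_proj c (?\<mu> k) F' b \<noteq> 0"
    by (metis (mono_tags, lifting) lessThan_iff sum.neutral)
  have \<mu>: "?\<mu> k ^ ?N = 1" using N by (simp add: DeMoivre cis_multiple_2pi)
  show ?case
  proof (intro exI[of _ "shift_proj c (?\<mu> k) F'"] conjI ballI)
    fix b assume "b \<in> carrier G"
    then show "shift_proj c (?\<mu> k) F' (a \<otimes> b) = \<nu> * shift_proj c (?\<mu> k) F' b"
      using F' assms(4) c by (intro shift_proj_commute) auto
  next
    show "\<exists>b\<in>carrier G. shift_proj c (?\<mu> k) F' b \<noteq> 0" using k b by blast
  next
    fix d assume d: "d \<in> insert c S"
    show "\<exists>\<kappa>. \<forall>b\<in>carrier G. shift_proj c (?\<mu> k) F' (d \<otimes> b) = \<kappa> * shift_proj c (?\<mu> k) F' b"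
    proof (cases "d = c")
      case True
      then show ?thesis using shift_proj_eigen[OF assms(1) c _ \<mu>] by blast
    next
      case False
      with d S obtain \<kappa> where "\<forall>b\<in>carrier G. F' (d \<otimes> b) = \<kappa> * F' b" by blast
      then show ?thesis using c d insert.prems
        by (intro exI[of _ \<kappa>] ballI shift_proj_commute) auto
    qed
  qed
qed

text \<open>Decompose the point mass at the identity under translation by \<open>a\<close>. If only
  the component with eigenvalue 1 survived, the point mass would take equal values at
  \<open>a\<close> and at the identity. A surviving component with another eigenvalue is refined to
  a common eigenfunction, whose eigenvalues form the character.\<close>

lemma (in comm_group) char_separates:
  assumes fin: "finite (carrier G)" and a: "a \<in> carrier G" "a \<noteq> \<one>"
  shows "\<exists>\<chi>\<in>chars G. \<chi> a \<noteq> 1"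
proof -
  let ?N = "Coset.order G"
  let ?\<mu> = "\<lambda>k. cis (2 * pi * real k / real ?N)"
  let ?\<delta> = "\<lambda>b. if b = \<one> then 1 else 0 :: complex"
  have N: "?N > 0" using fin by (simp add: order_gt_0_iff_finite)
  have "\<exists>k<?N. \<exists>b\<in>carrier G. ?\<mu> k \<noteq> 1 \<and> shift_proj a (?\<mu> k) ?\<delta> b \<noteq> 0"
  proof (rule ccontr)
    assume "\<not> ?thesis"
    then have *: "shift_proj a (?\<mu> k) ?\<delta> b = 0" if "k < ?N" "b \<in> carrier G" "?\<mu> k \<noteq> 1" for k b
      using that by blast
    have "shift_proj a (?\<mu> k) ?\<delta> (a \<otimes> \<one>) = shift_proj a (?\<mu> k) ?\<delta> \<one>" if "k < ?N" for k
    proof (cases "?\<mu> k = 1")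
      case True
      then show ?thesis using shift_proj_eigen[OF fin a(1) one_closed, of 1 ?\<delta>] by simp
    next
      case False
      then show ?thesis using * that a by simp
    qed
    then have "of_nat ?N * ?\<delta> (a \<otimes> \<one>) = of_nat ?N * ?\<delta> \<one>"
      using sum_shift_proj[OF fin a(1), of "a \<otimes> \<one>" ?\<delta>] sum_shift_proj[OF fin a(1) one_closed, of ?\<delta>]
        a(1) by (metis (mono_tags, lifting) lessThan_iff m_closed one_closed sum.cong)
    then show False using a N by simp
  qed
  then obtain k b where k: "k < ?N" "b \<in> carrier G" "?\<mu> k \<noteq> 1" "shift_proj a (?\<mu> k) ?\<delta> b \<noteq> 0"
    by blast
  have \<mu>: "?\<mu> k ^ ?N = 1" using N by (simp add: DeMoivre cis_multiple_2pi)
  from common_eigenfunction[OF fin fin subset_refl a(1)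
      shift_proj_eigen[OF fin a(1) _ \<mu>] k(2) k(4)]
  obtain F where F: "\<forall>b\<in>carrier G. F (a \<otimes> b) = inverse (?\<mu> k) * F b"
    "\<exists>b\<in>carrier G. F b \<noteq> 0" "\<forall>d\<in>carrier G. \<exists>\<kappa>. \<forall>b\<in>carrier G. F (d \<otimes> b) = \<kappa> * F b"
    by blast
  from F(3) obtain \<chi> where \<chi>: "\<And>d b. d \<in> carrier G \<Longrightarrow> b \<in> carrier G \<Longrightarrow> F (d \<otimes> b) = \<chi> d * F b"
    by metis
  \<comment> \<open>Each value \<open>F d\<close> is \<open>\<chi> d * F \<one>\<close>, so a zero
    at the identity would make \<open>F\<close> vanish on the whole carrier.\<close>
  have F1: "F \<one> \<noteq> 0"
    using F(2) \<chi>[OF _ one_closed] by force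
  have "is_char G \<chi>"
    unfolding is_char_def
  proof (intro conjI ballI)
    show "\<chi> \<one> = 1" using \<chi>[of \<one> \<one>] F1 by simp
    fix c d assume cd: "c \<in> carrier G" "d \<in> carrier G"
    have "\<chi> (c \<otimes> d) * F \<one> = \<chi> c * \<chi> d * F \<one>"
      using cd \<chi>[of "c \<otimes> d" \<one>] \<chi>[of c d] \<chi>[of d \<one>]
      by (simp only: mult.assoc r_one one_closed m_closed)
    then show "\<chi> (c \<otimes> d) = \<chi> c * \<chi> d" using F1 by simp
  qed
  moreover have "\<chi> a = inverse (?\<mu> k)"
    using \<chi>[OF a(1) one_closed] F(1) F1 by simp
  then have "\<chi> a \<noteq> 1" using k(3) by (metis inverse_1 inverse_inverse_eq)
  ultimately show ?thesis
    using a is_char_restrict by (intro bexI[of _ "restrict \<chi> (carrier G)"]) auto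
qed

text \<open>Multiplication by a character \<open>\<phi>\<close> with \<open>\<phi> a\<close>
  different from 1 permutes the characters and multiplies the sum by \<open>\<phi> a\<close>.
  Separation of points provides such a \<open>\<phi>\<close>.\<close>

lemma (in comm_group) sum_chars:
  assumes fin: "finite (carrier G)" and a: "a \<in> carrier G"
  shows "(\<Sum>\<chi>\<in>chars G. \<chi> a) = (if a = \<one> then of_nat (card (chars G)) else 0)"
proof (cases "a = \<one>")
  case True
  then show ?thesis by (simp add: chars_def is_char_one)
next
  case False
  from char_separates[OF fin a False] obtain \<phi> where \<phi>: "\<phi> \<in> chars G" "\<phi> a \<noteq> 1" by blast
  define \<theta> where "\<theta> \<chi> = (\<lambda>b\<in>carrier G. \<phi> b * \<chi> b)" for \<chi> :: "'a \<Rightarrow> complex"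
  have maps: "\<theta> ` chars G \<subseteq> chars G"
    using \<phi> by (auto simp: \<theta>_def chars_def is_char_def)
  have inj: "inj_on \<theta> (chars G)"
  proof (rule inj_onI)
    fix \<chi> \<chi>' assume *: "\<chi> \<in> chars G" "\<chi>' \<in> chars G" "\<theta> \<chi> = \<theta> \<chi>'"
    show "\<chi> = \<chi>'"
    proof (rule extensionalityI)
      fix b assume b: "b \<in> carrier G"
      then have "\<phi> b * \<chi> b = \<phi> b * \<chi>' b" using fun_cong[OF *(3), of b] by (simp add: \<theta>_def)
      then show "\<chi> b = \<chi>' b" using is_char_nonzero[of \<phi> b] \<phi> b by (simp add: chars_def)
    qed (use * in \<open>auto simp: chars_def\<close>)
  qed
  have "\<theta> ` chars G = chars G"
    using endo_inj_surj[OF finite_chars[OF fin] maps inj] .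
  then have "(\<Sum>\<chi>\<in>chars G. \<chi> a) = (\<Sum>\<chi>\<in>chars G. \<theta> \<chi> a)"
    using sum.reindex[OF inj, of "\<lambda>\<chi>. \<chi> a"] by simp
  also have "\<dots> = \<phi> a * (\<Sum>\<chi>\<in>chars G. \<chi> a)"
    using a by (simp add: \<theta>_def sum_distrib_left)
  finally show ?thesis using \<phi>(2) False by simp
qed

text \<open>The dual relation: the carrier is translated by an element \<open>c\<close> at which
  \<open>\<chi>\<close> is not 1.\<close>

lemma (in group) sum_char:
  assumes fin: "finite (carrier G)" and \<chi>: "\<chi> \<in> chars G"
  shows "(\<Sum>a\<in>carrier G. \<chi> a) = (if \<chi> = (\<lambda>a\<in>carrier G. 1) then of_nat (Coset.order G) else 0)"
proof (cases "\<chi> = (\<lambda>a\<in>carrier G. 1)")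
  case True
  then show ?thesis by (simp add: Coset.order_def)
next
  case False
  then obtain c where c: "c \<in> carrier G" "\<chi> c \<noteq> 1"
    using \<chi> by (metis (mono_tags, lifting) chars_def extensionalityI mem_Collect_eq restrict_apply' restrict_extensional)
  have bij: "bij_betw (\<lambda>a. c \<otimes> a) (carrier G) (carrier G)"
    using c(1) by (intro bij_betwI[where g = "\<lambda>a. inv c \<otimes> a"]) (auto simp: m_assoc[symmetric])
  have "(\<Sum>a\<in>carrier G. \<chi> a) = (\<Sum>a\<in>carrier G. \<chi> (c \<otimes> a))"
    using sum.reindex_bij_betw[OF bij, of \<chi>] by simp
  also have "\<dots> = \<chi> c * (\<Sum>a\<in>carrier G. \<chi> a)"
    using \<chi> c(1) by (simp add: sum_distrib_left is_char_mult chars_def)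
  finally show ?thesis using c(2) False by simp
qed

text \<open>The double sum of \<open>\<chi> a\<close> is evaluated in both orders: summing over
  characters first gives their number, summing over elements first gives the group order.\<close>

lemma (in comm_group) card_chars:
  assumes fin: "finite (carrier G)"
  shows "card (chars G) = Coset.order G"
proof -
  have triv: "(\<lambda>a\<in>carrier G. 1) \<in> chars G"
    by (simp add: chars_def is_char_def)
  have "(\<Sum>a\<in>carrier G. \<Sum>\<chi>\<in>chars G. \<chi> a) = (\<Sum>a\<in>carrier G. if a = \<one> then of_nat (card (chars G)) else 0)"
    by (intro sum.cong refl sum_chars fin)
  also have "\<dots> = (of_nat (card (chars G)) :: complex)"
    using fin by simp
  finally have "of_nat (card (chars G)) = (\<Sum>\<chi>\<in>chars G. \<Sum>a\<in>carrier G. \<chi> a)"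
    by (subst (asm) sum.swap) simp
  also have "\<dots> = (\<Sum>\<chi>\<in>chars G. if \<chi> = (\<lambda>a\<in>carrier G. 1) then of_nat (Coset.order G) else 0)"
    by (intro sum.cong refl sum_char fin)
  also have "\<dots> = (of_nat (Coset.order G) :: complex)"
    using finite_chars[OF fin] triv by simp
  finally show ?thesis by simp
qed

section \<open>Complex matrix representations\<close>

lemma carrier_GLC:
  "carrier (GLC n) = {P \<in> carrier_mat n n. \<exists>Q\<in>carrier_mat n n. Q * P = 1\<^sub>m n \<and> P * Q = 1\<^sub>m n}"
  by (auto simp: GLC_def units_of_carrier Units_def ring_mat_simps)

lemma mult_GLC [simp]: "mult (GLC n) = (*)"
  and one_GLC [simp]: "one (GLC n) = 1\<^sub>m n"
  by (simp_all add: GLC_def units_of_mult units_of_one ring_mat_simps)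

lemma group_GLC: "group (GLC n)"
proof -
  interpret ring "ring_mat TYPE(complex) n ()" by (rule ring_mat)
  show ?thesis unfolding GLC_def by (rule units_group)
qed

text \<open>Invertibility of \<open>\<rho> g\<close> follows from the multiplicative law, with
  inverse \<open>\<rho> (inv g)\<close>, so a representation is recognized by matrix identities
  alone.\<close>

lemma (in group) is_rep_iff:
  "is_rep G n \<rho> \<longleftrightarrow> (\<forall>g\<in>carrier G. \<rho> g \<in> carrier_mat n n) \<and> \<rho> \<one> = 1\<^sub>m n \<and>
     (\<forall>g\<in>carrier G. \<forall>h\<in>carrier G. \<rho> (g \<otimes> h) = \<rho> g * \<rho> h)"
proof
  assume r: "is_rep G n \<rho>"
  then interpret group_hom G "GLC n" \<rho>
    using group_GLC is_group by (simp add: group_hom_def group_hom_axioms_def is_rep_def)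
  show "(\<forall>g\<in>carrier G. \<rho> g \<in> carrier_mat n n) \<and> \<rho> \<one> = 1\<^sub>m n \<and>
     (\<forall>g\<in>carrier G. \<forall>h\<in>carrier G. \<rho> (g \<otimes> h) = \<rho> g * \<rho> h)"
    using hom_closed hom_one hom_mult by (auto simp: carrier_GLC)
next
  assume r: "(\<forall>g\<in>carrier G. \<rho> g \<in> carrier_mat n n) \<and> \<rho> \<one> = 1\<^sub>m n \<and>
     (\<forall>g\<in>carrier G. \<forall>h\<in>carrier G. \<rho> (g \<otimes> h) = \<rho> g * \<rho> h)"
  have "\<rho> g \<in> carrier (GLC n)" if g: "g \<in> carrier G" for g
    unfolding carrier_GLC mem_Collect_eq
  proof (intro conjI bexI)
    show "\<rho> (inv g) * \<rho> g = 1\<^sub>m n"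
      using r g inv_closed[OF g] l_inv[OF g] by metis
    show "\<rho> g * \<rho> (inv g) = 1\<^sub>m n"
      using r g inv_closed[OF g] r_inv[OF g] by metis
  qed (use r g in auto)
  then show "is_rep G n \<rho>"
    using r by (auto simp: is_rep_def hom_def)
qed

lemma (in group) is_rep_carrier: "is_rep G n \<rho> \<Longrightarrow> g \<in> carrier G \<Longrightarrow> \<rho> g \<in> carrier_mat n n"
  by (simp add: is_rep_iff)

lemma (in group) is_rep_mult:
  "is_rep G n \<rho> \<Longrightarrow> g \<in> carrier G \<Longrightarrow> h \<in> carrier G \<Longrightarrow> \<rho> (g \<otimes> h) = \<rho> g * \<rho> h"
  by (simp add: is_rep_iff)

lemma (in group) is_rep_dim_unique: "is_rep G n \<rho> \<Longrightarrow> is_rep G m \<rho> \<Longrightarrow> n = m"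
  using is_rep_carrier[of n \<rho> \<one>] is_rep_carrier[of m \<rho> \<one>] by auto

lemma is_rep_compose_hom:
  "is_rep G n \<rho> \<Longrightarrow> h \<in> hom H G \<Longrightarrow> is_rep H n (\<lambda>a. \<rho> (h a))"
  by (auto simp: is_rep_def hom_def)

lemma subspace_iff:
  "VectorSpace.subspace class_ring W (module_vec TYPE(complex) n) \<longleftrightarrow>
     W \<subseteq> carrier_vec n \<and> 0\<^sub>v n \<in> W \<and> (\<forall>v\<in>W. \<forall>w\<in>W. v + w \<in> W) \<and> (\<forall>c. \<forall>v\<in>W. c \<cdot>\<^sub>v v \<in> W)"
proof -
  interpret vec_space "TYPE(complex)" n .
  show ?thesis
    using vectorspace_axioms module_axioms
    by (auto simp: VectorSpace.subspace_def submodule_def module_vec_simps class_ring_simps)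
qed

lemma is_irrepD:
  assumes "is_irrep G n \<rho>"
    and "W \<subseteq> carrier_vec n" "0\<^sub>v n \<in> W" "\<And>v w. v \<in> W \<Longrightarrow> w \<in> W \<Longrightarrow> v + w \<in> W"
    and "\<And>c v. v \<in> W \<Longrightarrow> c \<cdot>\<^sub>v v \<in> W"
    and "\<And>g w. g \<in> carrier G \<Longrightarrow> w \<in> W \<Longrightarrow> \<rho> g *\<^sub>v w \<in> W"
  shows "W = {0\<^sub>v n} \<or> W = carrier_vec n"
proof -
  have "VectorSpace.subspace class_ring W (module_vec TYPE(complex) n)"
    using assms(2-5) by (simp add: subspace_iff)
  then show ?thesis using assms(1,6) by (simp add: is_irrep_def)
qed

section \<open>Schur's lemma for rectangular intertwiners\<close>

lemma mult_mat_zero_vec: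
  fixes M :: "complex mat"
  shows "M \<in> carrier_mat r c \<Longrightarrow> M *\<^sub>v 0\<^sub>v c = 0\<^sub>v r"
  by (intro eq_vecI) auto

lemma mult_mat_unit_vec:
  fixes M :: "complex mat"
  assumes "M \<in> carrier_mat r c" "j < c"
  shows "M *\<^sub>v unit_vec c j = col M j"
  using assms by (intro eq_vecI) (auto simp: scalar_prod_right_unit)

text \<open>The image of \<open>Q\<close> is invariant and nonzero, its kernel invariant and proper,
  so irreducibility makes \<open>Q\<close> bijective. The dimensions may differ a priori because in
  the applications only \<open>m\<close> is known.\<close>

lemma (in group) schur_equiv_rep:
  assumes \<sigma>: "is_irrep G n \<sigma>" and \<rho>: "is_irrep G m \<rho>"
    and Q: "Q \<in> carrier_mat n m" "Q \<noteq> 0\<^sub>m n m"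
    and comm: "\<And>g. g \<in> carrier G \<Longrightarrow> \<sigma> g * Q = Q * \<rho> g"
  shows "equiv_rep G \<sigma> \<rho>" and "n = m"
proof -
  have rep: "is_rep G n \<sigma>" "is_rep G m \<rho>" using \<sigma> \<rho> by (auto simp: is_irrep_def)
  note [simp] = is_rep_carrier[OF rep(1)] is_rep_carrier[OF rep(2)]
  have Qcomm: "\<sigma> g *\<^sub>v (Q *\<^sub>v u) = Q *\<^sub>v (\<rho> g *\<^sub>v u)" if "g \<in> carrier G" "u \<in> carrier_vec m" for g u
    using comm[OF that(1)] that Q(1) assoc_mult_mat_vec[of "\<sigma> g" n n Q m u]
      assoc_mult_mat_vec[of Q n m "\<rho> g" m u] by simp
  let ?W = "{Q *\<^sub>v u | u. u \<in> carrier_vec m}"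
  let ?K = "{u \<in> carrier_vec m. Q *\<^sub>v u = 0\<^sub>v n}"
  have "\<exists>j<m. col Q j \<noteq> 0\<^sub>v n"
  proof (rule ccontr)
    assume "\<not> ?thesis"
    then have *: "col Q j = 0\<^sub>v n" if "j < m" for j using that by blast
    have "Q $$ (i, j) = 0" if "i < n" "j < m" for i j
      using arg_cong[OF *[OF that(2)], of "\<lambda>v. v $ i"] that Q(1) by simp
    then have "Q = 0\<^sub>m n m" using Q(1) by (intro eq_matI) auto
    with Q show False by simp
  qed
  then obtain j where j: "j < m" "col Q j \<noteq> 0\<^sub>v n" by blast
  have Qj: "Q *\<^sub>v unit_vec m j \<noteq> 0\<^sub>v n"
    using Q j by (simp add: mult_mat_unit_vec)
  have "?W = {0\<^sub>v n} \<or> ?W = carrier_vec n"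
  proof (rule is_irrepD[OF \<sigma>])
    show "?W \<subseteq> carrier_vec n" using Q by auto
    show "0\<^sub>v n \<in> ?W" using Q by (auto intro!: exI[of _ "0\<^sub>v m"])
    show "v + w \<in> ?W" if "v \<in> ?W" "w \<in> ?W" for v w
    proof -
      from that obtain u u' where "u \<in> carrier_vec m" "u' \<in> carrier_vec m" "v = Q *\<^sub>v u" "w = Q *\<^sub>v u'"
        by blast
      then show ?thesis using Q by (auto simp: mult_add_distrib_mat_vec[OF Q(1), symmetric])
    qed
    show "c \<cdot>\<^sub>v v \<in> ?W" if "v \<in> ?W" for c v
    proof -
      from that obtain u where "u \<in> carrier_vec m" "v = Q *\<^sub>v u" by blast
      then show ?thesis using Q by (auto simp: mult_mat_vec[OF Q(1), symmetric])
    qed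
    show "\<sigma> g *\<^sub>v w \<in> ?W" if "g \<in> carrier G" "w \<in> ?W" for g w
    proof -
      from that obtain u where "u \<in> carrier_vec m" "w = Q *\<^sub>v u" by blast
      then show ?thesis using Qcomm[OF that(1)] that
        by (auto intro!: exI[of _ "\<rho> g *\<^sub>v u"] mult_mat_vec_carrier)
    qed
  qed
  moreover have "Q *\<^sub>v unit_vec m j \<in> ?W" by (rule CollectI) (auto intro!: exI[of _ "unit_vec m j"])
  ultimately have W: "?W = carrier_vec n" using Qj by blast
  have "?K = {0\<^sub>v m} \<or> ?K = carrier_vec m"
  proof (rule is_irrepD[OF \<rho>])
    show "0\<^sub>v m \<in> ?K" using Q by auto
    show "v + w \<in> ?K" if "v \<in> ?K" "w \<in> ?K" for v w
      using that by (simp add: mult_add_distrib_mat_vec[OF Q(1)])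
    show "c \<cdot>\<^sub>v v \<in> ?K" if "v \<in> ?K" for c v
      using that by (auto simp: mult_mat_vec[OF Q(1)])
    show "\<rho> g *\<^sub>v w \<in> ?K" if "g \<in> carrier G" "w \<in> ?K" for g w
      using that Qcomm[of g w] mult_mat_vec_carrier[of "\<rho> g" m m w]
        mult_mat_zero_vec[OF is_rep_carrier[OF rep(1) that(1)]] by auto
  qed auto
  moreover have "unit_vec m j \<notin> ?K" using Qj by simp
  ultimately have K: "?K = {0\<^sub>v m}" using unit_vec_carrier[of m j] by blast
  \<comment> \<open>Preimages of the unit vectors under the surjection \<open>Q\<close> become the
    columns of its inverse \<open>P\<close>.\<close>
  have "\<forall>i<n. \<exists>u. u \<in> carrier_vec m \<and> Q *\<^sub>v u = unit_vec n i"
  proof (intro allI impI)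
    fix i assume "i < n"
    have "unit_vec n i \<in> ?W" unfolding W by simp
    then show "\<exists>u. u \<in> carrier_vec m \<and> Q *\<^sub>v u = unit_vec n i" by (smt (verit) mem_Collect_eq)
  qed
  then obtain u where u: "\<And>i. i < n \<Longrightarrow> u i \<in> carrier_vec m \<and> Q *\<^sub>v u i = unit_vec n i" by metis
  define P where "P = mat m n (\<lambda>(k, i). u i $ k)"
  have P: "P \<in> carrier_mat m n" by (simp add: P_def)
  have colP: "col P i = u i" if "i < n" for i
    using u[OF that] that by (intro eq_vecI) (auto simp: P_def)
  have QP: "Q * P = 1\<^sub>m n"
  proof (rule eq_matI)
    fix i k assume ik: "i < dim_row (1\<^sub>m n)" "k < dim_col (1\<^sub>m n)"
    then have "(Q * P) $$ (i, k) = (Q *\<^sub>v u k) $ i"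
      using Q P colP by simp
    also have "\<dots> = 1\<^sub>m n $$ (i, k)" using ik u by simp
    finally show "(Q * P) $$ (i, k) = 1\<^sub>m n $$ (i, k)" .
  qed (use Q P in auto)
  \<comment> \<open>\<open>Q\<close> sends \<open>P (Q e) - e\<close> to zero since
    \<open>Q * P\<close> is the identity, and the kernel of \<open>Q\<close> is trivial.\<close>
  have PQ: "P * Q = 1\<^sub>m m"
  proof (rule eq_matI)
    fix k i assume "k < dim_row (1\<^sub>m m)" "i < dim_col (1\<^sub>m m)"
    then have ki: "k < m" "i < m" by simp_all
    let ?e = "unit_vec m i"
    let ?v = "P *\<^sub>v (Q *\<^sub>v ?e)"
    have v: "?v \<in> carrier_vec m" using P Q by auto
    have "Q *\<^sub>v ?v = Q * P *\<^sub>v (Q *\<^sub>v ?e)"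
      using Q P by (intro assoc_mult_mat_vec[symmetric]) auto
    also have "\<dots> = Q *\<^sub>v ?e" using QP Q by (simp add: mult_mat_vec_carrier[OF Q(1)])
    finally have "Q *\<^sub>v (?v - ?e) = Q *\<^sub>v ?e - Q *\<^sub>v ?e"
      using mult_minus_distrib_mat_vec[OF Q(1) v, of ?e] by simp
    then have "?v - ?e \<in> ?K" using v Q(1) by (simp add: minus_cancel_vec[OF mult_mat_vec_carrier[OF Q(1)]])
    then have "?v - ?e = 0\<^sub>v m" using K by blast
    from arg_cong[OF this, of "\<lambda>w. w $ k"] have "?v $ k = ?e $ k"
      using ki by simp
    moreover have "?v $ k = (P * Q) $$ (k, i)"
      using ki P Q by (simp add: mult_mat_unit_vec[OF Q(1)])
    ultimately show "(P * Q) $$ (k, i) = 1\<^sub>m m $$ (k, i)" using ki by simp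
  qed (use P Q in auto)
  \<comment> \<open>The traces of \<open>Q * P\<close> and \<open>P * Q\<close> agree; being
    \<open>n\<close> and \<open>m\<close> as complex numbers, they give
    \<open>n = m\<close>.\<close>
  have tr: "(\<Sum>i<r. (M * N) $$ (i, i)) = (\<Sum>i<r. \<Sum>k<s. M $$ (i, k) * N $$ (k, i))"
    if "M \<in> carrier_mat r s" "N \<in> carrier_mat s r" for M N :: "complex mat" and r s
    using that by (intro sum.cong refl) (auto simp: scalar_prod_def atLeast0LessThan)
  have "of_nat n = (\<Sum>i<n. (Q * P) $$ (i, i))" by (simp add: QP)
  also have "\<dots> = (\<Sum>i<m. (P * Q) $$ (i, i))"
    unfolding tr[OF Q(1) P] tr[OF P Q(1)] by (subst sum.swap) (simp add: mult.commute)
  also have "\<dots> = of_nat m" by (simp add: PQ)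
  finally show nm: "n = m" by simp
  have PG: "P \<in> carrier (GLC n)" using P Q(1) PQ QP nm by (auto simp: carrier_GLC)
  have "P * \<sigma> g = \<rho> g * P" if g: "g \<in> carrier G" for g
  proof -
    have c: "\<sigma> g \<in> carrier_mat n n" "\<rho> g \<in> carrier_mat n n" "P \<in> carrier_mat n n" "Q \<in> carrier_mat n n"
      using is_rep_carrier[OF rep(1) g] is_rep_carrier[OF rep(2) g] P Q(1) nm by simp_all
    have "P * \<sigma> g = P * (\<sigma> g * (Q * P))" using QP c by simp
    also have "\<dots> = P * (\<sigma> g * Q * P)"
      using assoc_mult_mat[OF c(1,4,3)] by simp
    also have "\<dots> = P * (Q * \<rho> g * P)" using comm[OF g] by simp
    also have "\<dots> = (P * Q) * (\<rho> g * P)"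
      using assoc_mult_mat[OF c(4,2,3)] assoc_mult_mat[OF c(3,4), of "\<rho> g * P" n] c by simp
    also have "\<dots> = \<rho> g * P" using PQ nm c by simp
    finally show ?thesis .
  qed
  then show "equiv_rep G \<sigma> \<rho>"
    using rep PG nm by (auto simp: equiv_rep_def)
qed

section \<open>One-dimensional representations and characters\<close>

lemma mat1_carrier [simp]: "mat1 c \<in> carrier_mat 1 1"
  and entry1_mat1 [simp]: "entry1 (mat1 c) = c"
  and mat1_1: "mat1 1 = 1\<^sub>m 1"
  by (auto simp: mat1_def entry1_def mat_of_rows_list_def)

lemmas mat1_carrier_Suc [simp] = mat1_carrier[unfolded One_nat_def]

lemma mat1_entry1: "M \<in> carrier_mat 1 1 \<Longrightarrow> mat1 (entry1 M) = M"
  by (intro eq_matI) (auto simp: mat1_def entry1_def mat_of_rows_list_def)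

lemma mat1_eq_iff [simp]: "mat1 c = mat1 d \<longleftrightarrow> c = d"
  by (metis entry1_mat1)

lemma entry1_mult:
  "M \<in> carrier_mat 1 1 \<Longrightarrow> N \<in> carrier_mat 1 1 \<Longrightarrow> entry1 (M * N) = entry1 M * entry1 N"
  by (simp add: entry1_def scalar_prod_def)

lemma mat1_mult: "mat1 c * mat1 d = mat1 (c * d)"
  using entry1_mult[of "mat1 c" "mat1 d"] mat1_entry1[OF mult_carrier_mat[OF mat1_carrier mat1_carrier], of c d]
  by simp

lemma (in group) is_rep_1_char: "is_rep G 1 \<rho> \<Longrightarrow> is_char G (\<lambda>g. entry1 (\<rho> g))"
  using entry1_mat1[of 1] by (auto simp: is_rep_iff is_char_def entry1_mult mat1_1 simp del: entry1_mat1)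

lemma (in group) is_rep_mat1: "is_char G \<chi> \<Longrightarrow> is_rep G 1 (\<lambda>g. mat1 (\<chi> g))"
  by (auto simp: is_rep_iff is_char_def mat1_mult mat1_1)

lemma (in group) is_rep_1_irrep:
  assumes "is_rep G 1 \<rho>"
  shows "is_irrep G 1 \<rho>"
  unfolding is_irrep_def subspace_iff
proof (intro conjI allI impI assms)
  fix W :: "complex vec set"
  assume W: "W \<subseteq> carrier_vec 1 \<and> 0\<^sub>v 1 \<in> W \<and> (\<forall>v\<in>W. \<forall>w\<in>W. v + w \<in> W) \<and> (\<forall>c. \<forall>v\<in>W. c \<cdot>\<^sub>v v \<in> W)"
  show "W = {0\<^sub>v 1} \<or> W = carrier_vec 1"
  proof (cases "W \<subseteq> {0\<^sub>v 1}")
    case True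
    then show ?thesis using W by blast
  next
    case False
    then obtain w where w: "w \<in> W" "w \<noteq> 0\<^sub>v 1" by blast
    then have wc: "w \<in> carrier_vec 1" using W by blast
    have w0: "w $ 0 \<noteq> 0"
    proof
      assume "w $ 0 = 0"
      then have "w = 0\<^sub>v 1" using wc by (intro eq_vecI) auto
      with w show False by simp
    qed
    have "u \<in> W" if "u \<in> carrier_vec 1" for u
    proof -
      have "u = (u $ 0 / w $ 0) \<cdot>\<^sub>v w" using that wc w0 by (intro eq_vecI) auto
      then show ?thesis using W w(1) by metis
    qed
    then show ?thesis using W by blast
  qed
qed simp

lemma (in group) equiv_rep_dim:
  assumes "equiv_rep G \<rho> \<sigma>" "is_rep G n \<rho>"
  shows "is_rep G n \<sigma>"
  using assms is_rep_dim_unique unfolding equiv_rep_def by metis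

text \<open>Scalars commute, so conjugation changes nothing in dimension one. Equality is asserted
  on the carrier only, since values elsewhere are arbitrary.\<close>

lemma (in group) equiv_rep_1_iff:
  assumes \<rho>: "is_rep G 1 \<rho>"
  shows "equiv_rep G \<rho> \<sigma> \<longleftrightarrow> is_rep G 1 \<sigma> \<and> (\<forall>g\<in>carrier G. \<sigma> g = \<rho> g)"
proof
  assume e: "equiv_rep G \<rho> \<sigma>"
  then have \<sigma>: "is_rep G 1 \<sigma>" using equiv_rep_dim \<rho> by blast
  from e obtain n P where P: "is_rep G n \<rho>" "P \<in> carrier (GLC n)"
    "\<forall>g\<in>carrier G. P * \<rho> g = \<sigma> g * P" unfolding equiv_rep_def by blast
  have n: "n = 1" using P(1) \<rho> is_rep_dim_unique by blast
  have Pc: "P \<in> carrier_mat 1 1" and "\<exists>Q\<in>carrier_mat 1 1. P * Q = 1\<^sub>m 1"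
    using P(2) unfolding n carrier_GLC by auto
  then obtain Q where Q: "Q \<in> carrier_mat 1 1" "P * Q = 1\<^sub>m 1" by blast
  have "entry1 P * entry1 Q = 1"
    using entry1_mult[OF Pc Q(1)] Q(2) entry1_mat1[of 1] by (simp add: mat1_1 del: entry1_mat1)
  then have P0: "entry1 P \<noteq> 0" by auto
  have "\<sigma> g = \<rho> g" if g: "g \<in> carrier G" for g
  proof -
    have c: "\<rho> g \<in> carrier_mat 1 1" "\<sigma> g \<in> carrier_mat 1 1"
      using g \<rho> \<sigma> is_rep_carrier by blast+
    have "entry1 P * entry1 (\<rho> g) = entry1 (\<sigma> g) * entry1 P"
      using P(3) g entry1_mult[OF Pc c(1)] entry1_mult[OF c(2) Pc] by metis
    then have "entry1 (\<sigma> g) = entry1 (\<rho> g)" using P0 by simp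
    then show ?thesis using mat1_entry1 c by metis
  qed
  then show "is_rep G 1 \<sigma> \<and> (\<forall>g\<in>carrier G. \<sigma> g = \<rho> g)" using \<sigma> by blast
next
  assume \<sigma>: "is_rep G 1 \<sigma> \<and> (\<forall>g\<in>carrier G. \<sigma> g = \<rho> g)"
  have I: "1\<^sub>m 1 \<in> carrier (GLC 1)" by (auto simp: carrier_GLC intro!: bexI[of _ "1\<^sub>m 1"])
  have "1\<^sub>m 1 * \<rho> g = \<sigma> g * 1\<^sub>m 1" if "g \<in> carrier G" for g
    using \<sigma> that is_rep_carrier[OF \<rho> that] by simp
  then show "equiv_rep G \<rho> \<sigma>"
    unfolding equiv_rep_def using \<rho> \<sigma> I by blast
qed

lemma mult_mat_of_cols:
  fixes M :: "complex mat"
  assumes "M \<in> carrier_mat r n" "set vs \<subseteq> carrier_vec n"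
  shows "M * mat_of_cols n vs = mat_of_cols r (map ((*\<^sub>v) M) vs)"
  using assms by (intro eq_matI) (auto simp: mat_of_cols_index subset_iff)

text \<open>The character sums \<open>\<Sum>a. \<chi>(a\<inverse>) \<sigma>(a)\<close> project onto the simultaneous eigenspaces;
  by orthogonality they add up to a multiple of the identity, so one of them is nonzero.\<close>

lemma (in comm_group) common_eigenvector:
  assumes fin: "finite (carrier G)" and \<sigma>: "is_rep G n \<sigma>" and n: "n > 0"
  shows "\<exists>v\<in>carrier_vec n. v \<noteq> 0\<^sub>v n \<and> (\<exists>\<chi>\<in>chars G. \<forall>a\<in>carrier G. \<sigma> a *\<^sub>v v = \<chi> a \<cdot>\<^sub>v v)"
proof -
  define u :: "complex vec" where "u = unit_vec n 0"
  have u: "u \<in> carrier_vec n" by (simp add: u_def)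
  define w where "w \<chi> = vec n (\<lambda>i. \<Sum>a\<in>carrier G. \<chi> (inv a) * (\<sigma> a *\<^sub>v u) $ i)" for \<chi> :: "'a \<Rightarrow> complex"
  note c = is_rep_carrier[OF \<sigma>]
  \<comment> \<open>Only entry 0 is tracked: summing over the characters leaves the term of the
    identity, and \<open>u\<close> has entry 1 there, so the total is the positive number of
    characters.\<close>
  have "(\<Sum>\<chi>\<in>chars G. w \<chi> $ 0) = (\<Sum>a\<in>carrier G. (\<Sum>\<chi>\<in>chars G. \<chi> (inv a)) * (\<sigma> a *\<^sub>v u) $ 0)"
    using n by (simp add: w_def sum_distrib_right) (subst sum.swap, simp)
  also have "\<dots> = (\<Sum>a\<in>carrier G. if a = \<one> then of_nat (card (chars G)) * (\<sigma> \<one> *\<^sub>v u) $ 0 else 0)"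
    by (intro sum.cong) (auto simp: sum_chars[OF fin])
  also have "\<dots> = of_nat (card (chars G))"
    using fin n is_rep_iff \<sigma> by (simp add: u_def)
  finally have "(\<Sum>\<chi>\<in>chars G. w \<chi> $ 0) \<noteq> 0"
    using card_chars[OF fin] fin by (simp add: order_gt_0_iff_finite[symmetric])
  then obtain \<chi> where \<chi>: "\<chi> \<in> chars G" "w \<chi> $ 0 \<noteq> 0"
    by (meson sum.neutral)
  have ch: "is_char G \<chi>" using \<chi>(1) by (simp add: chars_def)
  have "\<sigma> b *\<^sub>v w \<chi> = \<chi> b \<cdot>\<^sub>v w \<chi>" if b: "b \<in> carrier G" for b
  proof (rule eq_vecI)
    fix i assume "i < dim_vec (\<chi> b \<cdot>\<^sub>v w \<chi>)"
    then have i: "i < n" by (simp add: w_def)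
    have bij: "bij_betw (\<lambda>a. b \<otimes> a) (carrier G) (carrier G)"
      using b by (intro bij_betwI[where g = "\<lambda>a. inv b \<otimes> a"]) (auto simp: m_assoc[symmetric])
    have "(\<sigma> b *\<^sub>v w \<chi>) $ i = (\<Sum>j<n. \<sigma> b $$ (i, j) * (\<Sum>a\<in>carrier G. \<chi> (inv a) * (\<sigma> a *\<^sub>v u) $ j))"
      using c[OF b] i by (simp add: scalar_prod_def w_def atLeast0LessThan)
    also have "\<dots> = (\<Sum>a\<in>carrier G. \<chi> (inv a) * (\<Sum>j<n. \<sigma> b $$ (i, j) * (\<sigma> a *\<^sub>v u) $ j))"
      unfolding sum_distrib_left by (subst sum.swap) (simp add: mult_ac)
    \<comment> \<open>Each summand is rewritten in terms of \<open>b \<otimes> a\<close>, as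
      \<open>\<chi> (inv a)\<close> is \<open>\<chi> b\<close> times
      \<open>\<chi> (inv (b \<otimes> a))\<close>; reindexing by \<open>bij\<close> then restores
      \<open>a\<close>.\<close>
    also have "\<dots> = (\<Sum>a\<in>carrier G. \<chi> b * (\<chi> (inv (b \<otimes> a)) * (\<sigma> (b \<otimes> a) *\<^sub>v u) $ i))"
    proof (rule sum.cong[OF refl])
      fix a assume a: "a \<in> carrier G"
      have "(\<Sum>j<n. \<sigma> b $$ (i, j) * (\<sigma> a *\<^sub>v u) $ j) = (\<sigma> b *\<^sub>v (\<sigma> a *\<^sub>v u)) $ i"
        using c[OF b] c[OF a] i by (simp add: scalar_prod_def[of "row (\<sigma> b) i"] atLeast0LessThan)
      also have "\<dots> = (\<sigma> (b \<otimes> a) *\<^sub>v u) $ i"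
        using assoc_mult_mat_vec[OF c[OF b] c[OF a] u] is_rep_mult[OF \<sigma> b a] by simp
      finally show "\<chi> (inv a) * (\<Sum>j<n. \<sigma> b $$ (i, j) * (\<sigma> a *\<^sub>v u) $ j)
          = \<chi> b * (\<chi> (inv (b \<otimes> a)) * (\<sigma> (b \<otimes> a) *\<^sub>v u) $ i)"
        using a b ch is_char_nonzero[OF ch b]
        by (simp add: is_char_inv is_char_mult)
    qed
    also have "\<dots> = \<chi> b * (\<Sum>a\<in>carrier G. \<chi> (inv a) * (\<sigma> a *\<^sub>v u) $ i)"
      using sum.reindex_bij_betw[OF bij, of "\<lambda>a. \<chi> (inv a) * (\<sigma> a *\<^sub>v u) $ i"]
      by (simp add: sum_distrib_left[symmetric])
    finally show "(\<sigma> b *\<^sub>v w \<chi>) $ i = (\<chi> b \<cdot>\<^sub>v w \<chi>) $ i"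
      using i by (simp add: w_def)
  qed (use c[OF b] in \<open>simp add: w_def\<close>)
  moreover have "w \<chi> \<noteq> 0\<^sub>v n" using \<chi>(2) n by auto
  moreover have "w \<chi> \<in> carrier_vec n" by (simp add: w_def)
  ultimately show ?thesis using \<chi>(1) by blast
qed

text \<open>The single column \<open>v\<close> intertwines the character with
  \<open>\<sigma>\<close>, so by Schur's lemma the whole space is the line spanned by
  \<open>v\<close>.\<close>

lemma (in group) equiv_rep_of_eigenvector:
  assumes \<sigma>: "is_irrep G n \<sigma>" and \<chi>: "is_char G \<chi>"
    and v: "v \<in> carrier_vec n" "v \<noteq> 0\<^sub>v n"
    and ev: "\<And>g. g \<in> carrier G \<Longrightarrow> \<sigma> g *\<^sub>v v = \<chi> g \<cdot>\<^sub>v v"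
  shows "equiv_rep G \<sigma> (\<lambda>g. mat1 (\<chi> g))" and "n = 1"
proof -
  let ?Q = "mat_of_cols n [v]"
  have c: "\<sigma> g \<in> carrier_mat n n" if "g \<in> carrier G" for g
    using \<sigma> that is_rep_carrier unfolding is_irrep_def by blast
  have Q: "?Q \<in> carrier_mat n 1" by (simp add: mat_of_cols_def)
  have "col ?Q 0 = v" using v(1) by simp
  then have "?Q \<noteq> 0\<^sub>m n 1" using v(2) by auto
  moreover have "\<sigma> g * ?Q = ?Q * mat1 (\<chi> g)" if g: "g \<in> carrier G" for g
  proof -
    have "\<sigma> g * ?Q = mat_of_cols n [\<chi> g \<cdot>\<^sub>v v]"
      using mult_mat_of_cols[OF c[OF g], of "[v]"] v(1) ev[OF g] by simp
    also have "\<dots> = ?Q * mat1 (\<chi> g)"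
      using v(1) by (intro eq_matI)
        (auto simp: mat_of_cols_def mat1_def mat_of_rows_list_def scalar_prod_def)
    finally show ?thesis .
  qed
  ultimately show "equiv_rep G \<sigma> (\<lambda>g. mat1 (\<chi> g))" and "n = 1"
    using schur_equiv_rep[OF \<sigma> is_rep_1_irrep[OF is_rep_mat1[OF \<chi>]] Q] by blast+
qed

lemma (in comm_group) is_irrep_iff:
  assumes "finite (carrier G)"
  shows "is_irrep G n \<sigma> \<longleftrightarrow> n = 1 \<and> is_rep G 1 \<sigma>"
proof
  assume \<sigma>: "is_irrep G n \<sigma>"
  then have r: "is_rep G n \<sigma>" "n > 0" by (auto simp: is_irrep_def)
  from common_eigenvector[OF assms r] obtain v \<chi> where "v \<in> carrier_vec n" "v \<noteq> 0\<^sub>v n"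
    "is_char G \<chi>" "\<forall>a\<in>carrier G. \<sigma> a *\<^sub>v v = \<chi> a \<cdot>\<^sub>v v" unfolding chars_def by blast
  with equiv_rep_of_eigenvector(2)[OF \<sigma>] have "n = 1" by blast
  then show "n = 1 \<and> is_rep G 1 \<sigma>" using r by simp
qed (use is_rep_1_irrep in blast)

lemma (in comm_group) irreps_eq:
  "finite (carrier G) \<Longrightarrow> irreps G = {\<sigma>. is_rep G 1 \<sigma>}"
  by (simp add: irreps_def is_irrep_iff)

lemma (in comm_group) irreps_ker_not_containing_eq:
  assumes "finite (carrier G)" "B \<subseteq> carrier G"
  shows "irreps_ker_not_containing G B = {\<sigma>. is_rep G 1 \<sigma> \<and> (\<exists>b\<in>B. entry1 (\<sigma> b) \<noteq> 1)}"
proof -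
  have "\<sigma> b = 1\<^sub>m 1 \<longleftrightarrow> entry1 (\<sigma> b) = 1" if "is_rep G 1 \<sigma>" "b \<in> carrier G" for \<sigma> b
    using mat1_entry1[OF is_rep_carrier[OF that]] by (metis mat1_1 entry1_mat1)
  then show ?thesis
    using assms by (auto simp: irreps_ker_not_containing_def is_irrep_iff kernel_def)
qed

text \<open>Extensional characters correspond one to one to classes of one-dimensional
  representations, so enumerating classes reduces to counting. Applied to all characters and to
  those nontrivial on \<open>B\<close>.\<close>

lemma (in group) enumerates_reps_mat1:
  assumes "bij_betw \<chi> {1..N} X" "X \<subseteq> chars G"
  shows "enumerates_reps G {\<sigma>. is_rep G 1 \<sigma> \<and> (\<lambda>g\<in>carrier G. entry1 (\<sigma> g)) \<in> X} N (\<lambda>j g. mat1 (\<chi> j g))"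
  unfolding enumerates_reps_def
proof (intro conjI ballI impI)
  have X: "\<chi> j \<in> X" and ch: "is_char G (\<chi> j)" and ext: "\<chi> j \<in> extensional (carrier G)"
    if "j \<in> {1..N}" for j
    using bij_betwE[OF assms(1)] assms(2) that unfolding chars_def by blast+
  have rep: "is_rep G 1 (\<lambda>g. mat1 (\<chi> j g))" if "j \<in> {1..N}" for j
    using is_rep_mat1[OF ch[OF that]] .
  show "(\<lambda>g. mat1 (\<chi> j g)) \<in> {\<sigma>. is_rep G 1 \<sigma> \<and> (\<lambda>g\<in>carrier G. entry1 (\<sigma> g)) \<in> X}"
    if "j \<in> {1..N}" for j
    using rep X ext that by (simp add: extensional_restrict)
  show "\<not> equiv_rep G (\<lambda>g. mat1 (\<chi> i g)) (\<lambda>g. mat1 (\<chi> j g))"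
    if i: "i \<in> {1..N}" and j: "j \<in> {1..N}" and ij: "i \<noteq> j" for i j
  proof
    assume "equiv_rep G (\<lambda>g. mat1 (\<chi> i g)) (\<lambda>g. mat1 (\<chi> j g))"
    then have "\<forall>g\<in>carrier G. \<chi> j g = \<chi> i g" using equiv_rep_1_iff[OF rep[OF i]] by simp
    then have "\<chi> i = \<chi> j" using ext[OF i] ext[OF j] by (intro extensionalityI) auto
    then show False using inj_onD[OF bij_betw_imp_inj_on[OF assms(1)] _ i j] ij by blast
  qed
  show "\<exists>j\<in>{1..N}. equiv_rep G \<sigma> (\<lambda>g. mat1 (\<chi> j g))"
    if "\<sigma> \<in> {\<sigma>. is_rep G 1 \<sigma> \<and> (\<lambda>g\<in>carrier G. entry1 (\<sigma> g)) \<in> X}" for \<sigma>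
  proof -
    from that have \<sigma>: "is_rep G 1 \<sigma>" and "(\<lambda>g\<in>carrier G. entry1 (\<sigma> g)) \<in> X" by auto
    then obtain j where j: "j \<in> {1..N}" "\<chi> j = (\<lambda>g\<in>carrier G. entry1 (\<sigma> g))"
      using bij_betw_imp_surj_on[OF assms(1)] by (metis imageE)
    then have "mat1 (\<chi> j g) = \<sigma> g" if "g \<in> carrier G" for g
      using that mat1_entry1[OF is_rep_carrier[OF \<sigma> that]] by simp
    then show ?thesis using equiv_rep_1_iff[OF \<sigma>] rep j(1) by blast
  qed
qed

lemma (in comm_group) enumerates_irreps_exists:
  assumes "finite (carrier G)"
  shows "\<exists>\<pi>. enumerates_reps G (irreps G) (Coset.order G) \<pi>"
proof -
  obtain \<chi> where "bij_betw \<chi> {1..Coset.order G} (chars G)"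
    using card_chars[OF assms] finite_chars[OF assms]
    by (metis card_atLeastAtMost diff_Suc_1 finite_atLeastAtMost finite_same_card_bij)
  from enumerates_reps_mat1[OF this subset_refl]
  have "enumerates_reps G {\<sigma>. is_rep G 1 \<sigma> \<and> (\<lambda>g\<in>carrier G. entry1 (\<sigma> g)) \<in> chars G}
    (Coset.order G) (\<lambda>j g. mat1 (\<chi> j g))" .
  moreover have "{\<sigma>. is_rep G 1 \<sigma> \<and> (\<lambda>g\<in>carrier G. entry1 (\<sigma> g)) \<in> chars G} = irreps G"
    using is_rep_1_char is_char_restrict by (auto simp: irreps_eq[OF assms])
  ultimately show ?thesis by auto
qed

section \<open>Groups given by generators and relators\<close>

fun gword_eval :: "('b, 'n) monoid_scheme \<Rightarrow> ('s \<Rightarrow> 'b) \<Rightarrow> 's gword \<Rightarrow> 'b" where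
  "gword_eval H \<phi> [] = \<one>\<^bsub>H\<^esub>"
| "gword_eval H \<phi> ((s, b) # w) = (if b then \<phi> s else inv\<^bsub>H\<^esub> \<phi> s) \<otimes>\<^bsub>H\<^esub> gword_eval H \<phi> w"

lemma Cons_in_gwords [simp]: "(s, b) # w \<in> gwords S \<longleftrightarrow> s \<in> S \<and> w \<in> gwords S"
  and Nil_in_gwords [simp]: "[] \<in> gwords S"
  by (auto simp: gwords_def)

context group
begin

lemma gword_eval_closed:
  "\<phi> \<in> S \<rightarrow> carrier G \<Longrightarrow> w \<in> gwords S \<Longrightarrow> gword_eval G \<phi> w \<in> carrier G"
  by (induction w) (auto simp: Pi_iff)

lemma gword_eval_append:
  assumes \<phi>: "\<phi> \<in> S \<rightarrow> carrier G" and v: "v \<in> gwords S"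
  shows "u \<in> gwords S \<Longrightarrow> gword_eval G \<phi> (u @ v) = gword_eval G \<phi> u \<otimes> gword_eval G \<phi> v"
proof (induction u)
  case Nil
  then show ?case using gword_eval_closed[OF \<phi> v] by simp
next
  case (Cons l u)
  obtain s b where l: "l = (s, b)" by (cases l)
  have "\<phi> s \<in> carrier G" "u \<in> gwords S" using Cons.prems \<phi> l by auto
  then show ?case
    using Cons.IH l gword_eval_closed[OF \<phi> v] gword_eval_closed[OF \<phi>, of u] by (simp add: m_assoc)
qed

text \<open>Each closure rule of \<open>pres_rel\<close> preserves the value; this is what makes the
  induced map on the presented group well defined.\<close>

lemma gword_eval_pres_rel:
  assumes \<phi>: "\<phi> \<in> S \<rightarrow> carrier G"
    and R: "\<And>r. r \<in> R \<Longrightarrow> r \<in> gwords S \<Longrightarrow> gword_eval G \<phi> r = \<one>"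
    and vw: "(v, w) \<in> pres_rel S R"
  shows "gword_eval G \<phi> v = gword_eval G \<phi> w"
  using vw
proof induction
  case (pres_cancel u v s b)
  have s: "\<phi> s \<in> carrier G" using pres_cancel \<phi> by auto
  have "gword_eval G \<phi> [(s, b), (s, \<not> b)] = \<one>" using s by (cases b) simp_all
  then show ?case
    using pres_cancel gword_eval_closed[OF \<phi>]
      gword_eval_append[OF \<phi>, of "[(s, b), (s, \<not> b)] @ v" u]
      gword_eval_append[OF \<phi>, of v "[(s, b), (s, \<not> b)]"] gword_eval_append[OF \<phi>, of v u]
    by simp
next
  case (pres_relator u v r)
  have "r @ v \<in> gwords S" using pres_relator by (simp add: gwords_def)
  then show ?case
    using pres_relator gword_eval_closed[OF \<phi>] R[of r]
      gword_eval_append[OF \<phi>, of "r @ v" u]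
      gword_eval_append[OF \<phi>, of v r] gword_eval_append[OF \<phi>, of v u]
    by simp
qed auto

end

section \<open>Presented groups: relations, induction and universal property\<close>

lemma carrier_pres_group: "carrier (pres_group S R) = (\<lambda>w. pres_rel S R `` {w}) ` gwords S"
  by (auto simp: pres_group_def quotient_def)

lemma one_pres_group: "\<one>\<^bsub>pres_group S R\<^esub> = pres_rel S R `` {[]}"
  by (simp add: pres_group_def)

lemma pres_gen_closed: "s \<in> S \<Longrightarrow> pres_gen S R s \<in> carrier (pres_group S R)"
  by (auto simp: carrier_pres_group pres_gen_def)

text \<open>Classes of words become products of generators, so that relators can be read as
  equations between group elements.\<close>

lemma pres_class_eq_eval:
  "w \<in> gwords S \<Longrightarrow> pres_rel S R `` {w} = gword_eval (pres_group S R) (pres_gen S R) w"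
proof (induction w)
  case Nil
  then show ?case by (simp add: one_pres_group)
next
  case (Cons l w)
  interpret P: group "pres_group S R" by (rule group_pres_group)
  obtain s b where l: "l = (s, b)" by (cases l)
  then have s: "s \<in> S" and w: "w \<in> gwords S" using Cons.prems by auto
  have "pres_rel S R `` {[(s, False)]} = inv\<^bsub>pres_group S R\<^esub> pres_gen S R s"
  proof (rule P.inv_equality[symmetric])
    have "([] @ [(s, False), (s, \<not> False)] @ [], [] @ []) \<in> pres_rel S R"
      using s by (intro pres_cancel) auto
    then have "pres_rel S R `` {[(s, False)] @ [(s, True)]} = pres_rel S R `` {[]}"
      by (intro equiv_class_eq[OF equiv_pres_rel]) simp
    then show "pres_rel S R `` {[(s, False)]} \<otimes>\<^bsub>pres_group S R\<^esub> pres_gen S R s = \<one>\<^bsub>pres_group S R\<^esub>"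
      using s by (simp add: pres_gen_def pres_group_mult one_pres_group)
    show "pres_rel S R `` {[(s, False)]} \<in> carrier (pres_group S R)"
      using s by (auto simp: carrier_pres_group)
  qed (use s in \<open>auto intro: pres_gen_closed\<close>)
  then have "pres_rel S R `` {[l]} =
      (if b then pres_gen S R s else inv\<^bsub>pres_group S R\<^esub> pres_gen S R s)"
    using l by (cases b) (simp_all add: pres_gen_def)
  moreover have "pres_rel S R `` {l # w} = pres_rel S R `` {[l]} \<otimes>\<^bsub>pres_group S R\<^esub> pres_rel S R `` {w}"
    using s w l pres_group_mult[of "[l]" S w R] by simp
  ultimately show ?case using l Cons.IH[OF w] by simp
qed

lemma pres_relator_eval:
  assumes "r \<in> R" "r \<in> gwords S"
  shows "gword_eval (pres_group S R) (pres_gen S R) r = \<one>\<^bsub>pres_group S R\<^esub>"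
proof -
  have "([] @ r @ [], [] @ []) \<in> pres_rel S R" using assms by (intro pres_relator) auto
  then have "pres_rel S R `` {r} = pres_rel S R `` {[]}"
    by (intro equiv_class_eq[OF equiv_pres_rel]) simp
  then show ?thesis using pres_class_eq_eval[OF assms(2), of R] by (simp add: one_pres_group)
qed

lemma pres_group_induct:
  assumes g: "g \<in> carrier (pres_group S R)"
    and one: "P \<one>\<^bsub>pres_group S R\<^esub>"
    and gen: "\<And>s g. s \<in> S \<Longrightarrow> P g \<Longrightarrow> P (pres_gen S R s \<otimes>\<^bsub>pres_group S R\<^esub> g)"
    and inv: "\<And>s g. s \<in> S \<Longrightarrow> P g \<Longrightarrow> P (inv\<^bsub>pres_group S R\<^esub> pres_gen S R s \<otimes>\<^bsub>pres_group S R\<^esub> g)"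
  shows "P g"
proof -
  from g obtain w where w: "w \<in> gwords S" "g = gword_eval (pres_group S R) (pres_gen S R) w"
    by (auto simp: carrier_pres_group pres_class_eq_eval)
  have "P (gword_eval (pres_group S R) (pres_gen S R) w)"
    using w(1)
  proof (induction w)
    case (Cons l w)
    then show ?case using gen inv by (cases l) auto
  qed (simp add: one)
  then show ?thesis using w by simp
qed

text \<open>The universal property of a presentation (von Dyck). The map evaluates an arbitrary
  representative of a class; the choice is harmless because evaluation is constant on
  classes.\<close>

lemma (in group) pres_group_hom_exists:
  assumes \<phi>: "\<phi> \<in> S \<rightarrow> carrier G"
    and R: "\<And>r. r \<in> R \<Longrightarrow> r \<in> gwords S \<Longrightarrow> gword_eval G \<phi> r = \<one>"
  shows "\<exists>h\<in>hom (pres_group S R) G. \<forall>s\<in>S. h (pres_gen S R s) = \<phi> s"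
proof -
  define h where "h U = gword_eval G \<phi> (SOME w. w \<in> U)" for U
  have h: "h (pres_rel S R `` {w}) = gword_eval G \<phi> w" if w: "w \<in> gwords S" for w
  proof -
    have "w \<in> pres_rel S R `` {w}" using w by (auto intro: pres_refl)
    then have "(SOME u. u \<in> pres_rel S R `` {w}) \<in> pres_rel S R `` {w}"
      by (rule someI[of "\<lambda>u. u \<in> pres_rel S R `` {w}"])
    then show ?thesis
      using gword_eval_pres_rel[OF \<phi> R] by (simp add: h_def)
  qed
  show ?thesis
  proof (intro bexI ballI)
    show "h (pres_gen S R s) = \<phi> s" if "s \<in> S" for s
      using funcset_mem[OF \<phi> that] that by (simp add: pres_gen_def h)
    show "h \<in> hom (pres_group S R) G"
    proof (rule homI)
      fix U V assume "U \<in> carrier (pres_group S R)" "V \<in> carrier (pres_group S R)"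
      then obtain u v where uv: "u \<in> gwords S" "v \<in> gwords S"
        "U = pres_rel S R `` {u}" "V = pres_rel S R `` {v}"
        by (auto simp: carrier_pres_group)
      then have "u @ v \<in> gwords S" by (simp add: gwords_def)
      then show "h (U \<otimes>\<^bsub>pres_group S R\<^esub> V) = h U \<otimes> h V"
        using uv by (simp add: pres_group_mult h gword_eval_append[OF \<phi>])
    qed (auto simp: carrier_pres_group h gword_eval_closed[OF \<phi>])
  qed
qed

section \<open>The extension group\<close>

locale involutive_extension = comm_group A for A (structure) +
  fixes f :: "'a \<Rightarrow> 'a" and y :: 'a
  assumes fin: "finite (carrier A)"
    and f_hom: "f \<in> hom A A"
    and f_f: "a \<in> carrier A \<Longrightarrow> f (f a) = a"
    and y_closed [simp]: "y \<in> carrier A"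
    and f_y [simp]: "f y = y"
begin

abbreviation E where "E \<equiv> ext_group A f y"
abbreviation \<iota> where "\<iota> \<equiv> ext_base A f y"
abbreviation x where "x \<equiv> ext_elem A f y"

sublocale E: group E
  unfolding ext_group_def by (rule group_pres_group)

lemma f_closed [simp]: "a \<in> carrier A \<Longrightarrow> f a \<in> carrier A"
  using f_hom by (auto simp: hom_def)

lemma f_mult: "a \<in> carrier A \<Longrightarrow> b \<in> carrier A \<Longrightarrow> f (a \<otimes> b) = f a \<otimes> f b"
  using f_hom by (auto simp: hom_def)

lemma \<iota>_closed [simp]: "a \<in> carrier A \<Longrightarrow> \<iota> a \<in> carrier E"
  and x_closed [simp]: "x \<in> carrier E"
  by (auto simp: ext_base_def ext_elem_def ext_group_def ext_letters_def intro!: pres_gen_closed)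

lemma relator_eval:
  "r \<in> ext_relators A f y \<Longrightarrow> r \<in> gwords (ext_letters A) \<Longrightarrow>
    gword_eval E (pres_gen (ext_letters A) (ext_relators A f y)) r = \<one>\<^bsub>E\<^esub>"
  unfolding ext_group_def by (rule pres_relator_eval)

lemma \<iota>_mult:
  assumes "a \<in> carrier A" "b \<in> carrier A"
  shows "\<iota> (a \<otimes> b) = \<iota> a \<otimes>\<^bsub>E\<^esub> \<iota> b"
proof -
  have "\<iota> a \<otimes>\<^bsub>E\<^esub> (\<iota> b \<otimes>\<^bsub>E\<^esub> (inv\<^bsub>E\<^esub> \<iota> (a \<otimes> b) \<otimes>\<^bsub>E\<^esub> \<one>\<^bsub>E\<^esub>)) = \<one>\<^bsub>E\<^esub>"
    using relator_eval[of "[(Base a, True), (Base b, True), (Base (a \<otimes> b), False)]"] assms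
    by (auto simp: ext_relators_def ext_letters_def ext_base_def)
  then have "\<iota> a \<otimes>\<^bsub>E\<^esub> \<iota> b \<otimes>\<^bsub>E\<^esub> inv\<^bsub>E\<^esub> \<iota> (a \<otimes> b) = \<one>\<^bsub>E\<^esub>"
    using assms by (simp add: E.m_assoc)
  then show ?thesis using assms by (metis E.inv_solve_right E.l_one E.m_closed E.one_closed \<iota>_closed m_closed)
qed

lemma \<iota>_hom: "\<iota> \<in> hom A E"
  by (auto simp: hom_def \<iota>_mult)

lemma \<iota>_one: "\<iota> \<one> = \<one>\<^bsub>E\<^esub>"
  using hom_one[OF \<iota>_hom is_group E.is_group] .

lemma \<iota>_inv: "a \<in> carrier A \<Longrightarrow> inv\<^bsub>E\<^esub> \<iota> a = \<iota> (inv a)"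
  using \<iota>_mult[of "inv a" a] by (intro E.inv_equality) (auto simp: \<iota>_one)

lemma x_x: "x \<otimes>\<^bsub>E\<^esub> x = \<iota> y"
proof -
  have "x \<otimes>\<^bsub>E\<^esub> (x \<otimes>\<^bsub>E\<^esub> (inv\<^bsub>E\<^esub> \<iota> y \<otimes>\<^bsub>E\<^esub> \<one>\<^bsub>E\<^esub>)) = \<one>\<^bsub>E\<^esub>"
    using relator_eval[of "[(Ext, True), (Ext, True), (Base y, False)]"]
    by (auto simp: ext_relators_def ext_letters_def ext_base_def ext_elem_def)
  then have "x \<otimes>\<^bsub>E\<^esub> x \<otimes>\<^bsub>E\<^esub> inv\<^bsub>E\<^esub> \<iota> y = \<one>\<^bsub>E\<^esub>" by (simp add: E.m_assoc)
  then show ?thesis by (metis E.inv_solve_right E.l_one E.m_closed E.one_closed \<iota>_closed x_closed y_closed)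
qed

lemma x_\<iota>:
  assumes "a \<in> carrier A"
  shows "x \<otimes>\<^bsub>E\<^esub> \<iota> a = \<iota> (f a) \<otimes>\<^bsub>E\<^esub> x"
proof -
  have "x \<otimes>\<^bsub>E\<^esub> (\<iota> a \<otimes>\<^bsub>E\<^esub> (inv\<^bsub>E\<^esub> x \<otimes>\<^bsub>E\<^esub> (inv\<^bsub>E\<^esub> \<iota> (f a) \<otimes>\<^bsub>E\<^esub> \<one>\<^bsub>E\<^esub>))) = \<one>\<^bsub>E\<^esub>"
    using relator_eval[of "[(Ext, True), (Base a, True), (Ext, False), (Base (f a), False)]"] assms
    by (auto simp: ext_relators_def ext_letters_def ext_base_def ext_elem_def)
  then have "(x \<otimes>\<^bsub>E\<^esub> \<iota> a) \<otimes>\<^bsub>E\<^esub> inv\<^bsub>E\<^esub> (\<iota> (f a) \<otimes>\<^bsub>E\<^esub> x) = \<one>\<^bsub>E\<^esub>"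
    using assms by (simp add: E.m_assoc E.inv_mult_group)
  then show ?thesis using assms
    by (metis E.inv_solve_right E.l_one E.m_closed E.one_closed \<iota>_closed f_closed x_closed)
qed

text \<open>Expresses the inverse letter through \<open>x\<close> and \<open>A\<close>, so that the
  normal form need only be stable under \<open>x\<close> and base elements.\<close>

lemma x_inv: "inv\<^bsub>E\<^esub> x = \<iota> (inv y) \<otimes>\<^bsub>E\<^esub> x"
  using \<iota>_mult[of "inv y" y] by (intro E.inv_equality) (auto simp: E.m_assoc x_x \<iota>_one)

text \<open>The elements \<open>\<iota> a\<close> and \<open>x\<close> times
  \<open>\<iota> a\<close> include the identity and are stable under left multiplication by every
  generator and its inverse, hence exhaust the group.\<close>

lemma elem_cases:
  assumes "g \<in> carrier E"
  obtains a where "a \<in> carrier A" "g = \<iota> a" | a where "a \<in> carrier A" "g = x \<otimes>\<^bsub>E\<^esub> \<iota> a"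
proof -
  define P where "P g \<longleftrightarrow> (\<exists>a\<in>carrier A. g = \<iota> a \<or> g = x \<otimes>\<^bsub>E\<^esub> \<iota> a)" for g
  have base: "P (\<iota> b \<otimes>\<^bsub>E\<^esub> g)" if b: "b \<in> carrier A" and g: "P g" for b g
  proof -
    from g obtain a where a: "a \<in> carrier A" "g = \<iota> a \<or> g = x \<otimes>\<^bsub>E\<^esub> \<iota> a" by (auto simp: P_def)
    \<comment> \<open>Since \<open>f\<close> is its own inverse, the relation for \<open>f b\<close>
      moves \<open>b\<close> past \<open>x\<close> and turns it into \<open>f b\<close>.\<close>
    have "\<iota> b \<otimes>\<^bsub>E\<^esub> (x \<otimes>\<^bsub>E\<^esub> \<iota> a) = x \<otimes>\<^bsub>E\<^esub> \<iota> (f b \<otimes> a)"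
      using a(1) b x_\<iota>[of "f b"] by (simp add: f_f \<iota>_mult E.m_assoc[symmetric])
    then show ?thesis
      using a b \<iota>_mult[of b a] m_closed[of b a] m_closed[of "f b" a] f_closed[of b] unfolding P_def by metis
  qed
  have ext: "P (x \<otimes>\<^bsub>E\<^esub> g)" if g: "P g" for g
  proof -
    from g obtain a where a: "a \<in> carrier A" "g = \<iota> a \<or> g = x \<otimes>\<^bsub>E\<^esub> \<iota> a" by (auto simp: P_def)
    have "x \<otimes>\<^bsub>E\<^esub> (x \<otimes>\<^bsub>E\<^esub> \<iota> a) = \<iota> (y \<otimes> a)"
      using a(1) by (simp add: \<iota>_mult x_x E.m_assoc[symmetric])
    then show ?thesis using a m_closed[of y a] y_closed unfolding P_def by metis
  qed
  have carr: "g \<in> carrier E" if "P g" for g using that by (auto simp: P_def)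
  let ?gen = "pres_gen (ext_letters A) (ext_relators A f y)"
  have "P g"
  proof (rule pres_group_induct[where P = P, OF assms[unfolded ext_group_def]], fold ext_group_def)
    show "P \<one>\<^bsub>E\<^esub>" using \<iota>_one unfolding P_def by (metis one_closed)
  next
    fix s g assume "s \<in> ext_letters A" and g: "P g"
    then consider "?gen s = x" | b where "b \<in> carrier A" "?gen s = \<iota> b"
      by (auto simp: ext_letters_def ext_elem_def ext_base_def)
    then have "P (?gen s \<otimes>\<^bsub>E\<^esub> g) \<and> P (inv\<^bsub>E\<^esub> ?gen s \<otimes>\<^bsub>E\<^esub> g)"
    proof cases
      case 1
      have "P (\<iota> (inv y) \<otimes>\<^bsub>E\<^esub> (x \<otimes>\<^bsub>E\<^esub> g))" using base ext g by simp
      then have "P (inv\<^bsub>E\<^esub> x \<otimes>\<^bsub>E\<^esub> g)" using carr[OF g] by (simp add: x_inv E.m_assoc)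
      then show ?thesis using ext[OF g] by (simp add: 1)
    next
      case 2
      then show ?thesis using base[of "inv b"] base[of b] g by (simp add: \<iota>_inv)
    qed
    then show "P (?gen s \<otimes>\<^bsub>E\<^esub> g)" "P (inv\<^bsub>E\<^esub> ?gen s \<otimes>\<^bsub>E\<^esub> g)" by simp_all
  qed
  then show ?thesis using that by (auto simp: P_def)
qed

text \<open>Each family of relators becomes one hypothesis: \<open>\<alpha>\<close> is
  multiplicative, \<open>X\<close> squares to \<open>\<alpha> y\<close>, and \<open>X\<close>
  carries \<open>\<alpha> a\<close> to \<open>\<alpha> (f a)\<close>. The inverse of
  \<open>X\<close> is \<open>\<alpha> (inv y) * X\<close>.\<close>

lemma ext_rep_exists:
  assumes \<alpha>: "is_rep A n \<alpha>" and X: "X \<in> carrier_mat n n" "X * X = \<alpha> y"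
    and comm: "\<And>a. a \<in> carrier A \<Longrightarrow> X * \<alpha> a = \<alpha> (f a) * X"
  shows "\<exists>\<rho>. is_rep E n \<rho> \<and> \<rho> x = X \<and> (\<forall>a\<in>carrier A. \<rho> (\<iota> a) = \<alpha> a)"
proof -
  interpret H: group "GLC n" by (rule group_GLC)
  interpret \<alpha>: group_hom A "GLC n" \<alpha>
    using \<alpha> is_group by (simp add: group_hom_def group_hom_axioms_def is_rep_def H.is_group)
  note c = is_rep_carrier[OF \<alpha>]
  let ?Y = "\<alpha> (inv y)"
  have Y: "?Y \<in> carrier_mat n n" "?Y * \<alpha> y = 1\<^sub>m n" "\<alpha> y * ?Y = 1\<^sub>m n"
    using c[OF inv_closed[OF y_closed]] is_rep_mult[OF \<alpha>, of "inv y" y] is_rep_mult[OF \<alpha>, of y "inv y"]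
      is_rep_iff[of n \<alpha>] \<alpha> by (simp_all del: \<alpha>.hom_inv)
  \<comment> \<open>This makes \<open>X\<close> commute with \<open>\<alpha> (inv y)\<close>, so
    that the left inverse of \<open>X\<close> is a right inverse too.\<close>
  have fy: "f (inv y) = inv y"
  proof (rule inv_equality[symmetric])
    have "f (inv y) \<otimes> f y = f \<one>" using f_mult[of "inv y" y] by simp
    then show "f (inv y) \<otimes> y = \<one>" using hom_one[OF f_hom is_group is_group] by simp
  qed auto
  have "?Y * X * X = 1\<^sub>m n" using assoc_mult_mat[OF Y(1) X(1) X(1)] X(2) Y(2) by simp
  moreover have "X * (?Y * X) = 1\<^sub>m n"
    using comm[of "inv y"] fy X Y assoc_mult_mat[OF X(1) X(1) Y(1)] by simp
  ultimately have XG: "X \<in> carrier (GLC n)"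
    using X Y unfolding carrier_GLC by (auto intro!: bexI[of _ "?Y * X"])
  define \<phi> where "\<phi> s = (case s of Base a \<Rightarrow> \<alpha> a | Ext \<Rightarrow> X)" for s
  have \<phi>: "\<phi> \<in> ext_letters A \<rightarrow> carrier (GLC n)"
    using XG by (auto simp: \<phi>_def ext_letters_def)
  have "gword_eval (GLC n) \<phi> r = \<one>\<^bsub>GLC n\<^esub>" if r: "r \<in> ext_relators A f y" for r
  proof -
    from r consider
      a b where "a \<in> carrier A" "b \<in> carrier A" "r = [(Base a, True), (Base b, True), (Base (a \<otimes> b), False)]"
      | "r = [(Ext, True), (Ext, True), (Base y, False)]"
      | a where "a \<in> carrier A" "r = [(Ext, True), (Base a, True), (Ext, False), (Base (f a), False)]"
      unfolding ext_relators_def by blast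
    then show ?thesis
    proof cases
      case 1
      have "\<alpha> a \<otimes>\<^bsub>GLC n\<^esub> \<alpha> b \<otimes>\<^bsub>GLC n\<^esub> inv\<^bsub>GLC n\<^esub> \<alpha> (a \<otimes> b) = \<one>\<^bsub>GLC n\<^esub>"
        unfolding \<alpha>.hom_mult[OF 1(1,2), symmetric] using 1
        by (intro H.r_inv \<alpha>.hom_closed m_closed)
      then show ?thesis using 1 H.m_assoc[of "\<alpha> a" "\<alpha> b"] H.r_one[of "inv\<^bsub>GLC n\<^esub> \<alpha> (a \<otimes> b)"]
        by (simp add: \<phi>_def del: mult_GLC one_GLC \<alpha>.hom_mult)
    next
      case 2
      have "X \<otimes>\<^bsub>GLC n\<^esub> X \<otimes>\<^bsub>GLC n\<^esub> inv\<^bsub>GLC n\<^esub> \<alpha> y = \<one>\<^bsub>GLC n\<^esub>"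
        using X(2) H.r_inv[of "\<alpha> y"] by simp
      then show ?thesis using 2 XG H.m_assoc[of X X] H.r_one[of "inv\<^bsub>GLC n\<^esub> \<alpha> y"]
        by (simp add: \<phi>_def del: mult_GLC one_GLC)
    next
      case 3
      have "(X \<otimes>\<^bsub>GLC n\<^esub> \<alpha> a) \<otimes>\<^bsub>GLC n\<^esub> inv\<^bsub>GLC n\<^esub> (\<alpha> (f a) \<otimes>\<^bsub>GLC n\<^esub> X) = \<one>\<^bsub>GLC n\<^esub>"
        unfolding mult_GLC[of n] comm[OF 3(1)] unfolding mult_GLC[of n, symmetric]
        using XG 3
        by (intro H.r_inv H.m_closed \<alpha>.hom_closed f_closed)
      then show ?thesis using 3 XG
        by (simp add: \<phi>_def H.inv_mult_group H.m_assoc del: mult_GLC one_GLC)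
    qed
  qed
  from H.pres_group_hom_exists[OF \<phi> this]
  obtain h where h: "h \<in> hom E (GLC n)"
    "\<forall>s\<in>ext_letters A. h (pres_gen (ext_letters A) (ext_relators A f y) s) = \<phi> s"
    unfolding ext_group_def by blast
  then have "is_rep E n h \<and> h x = X \<and> (\<forall>a\<in>carrier A. h (\<iota> a) = \<alpha> a)"
    by (auto simp: is_rep_def ext_elem_def ext_base_def \<phi>_def ext_letters_def)
  then show ?thesis by blast
qed

end

section \<open>Two-dimensional representations\<close>

abbreviation (input) mat2 :: "complex \<Rightarrow> complex \<Rightarrow> complex \<Rightarrow> complex \<Rightarrow> complex mat" where
  "mat2 a b c d \<equiv> mat_of_rows_list 2 [[a, b], [c, d]]"

lemma mat2_dim [simp]: "dim_row (mat2 a b c d) = 2" "dim_col (mat2 a b c d) = 2"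
  by (simp_all add: mat_of_rows_list_def)

lemma mat2_carrier [simp]: "mat2 a b c d \<in> carrier_mat 2 2"
  by (rule carrier_matI) simp_all

lemma mat2_vec_carrier [simp]: "w \<in> carrier_vec 2 \<Longrightarrow> mat2 a b c d *\<^sub>v w \<in> carrier_vec 2"
  by (rule mult_mat_vec_carrier[OF mat2_carrier])

lemma mat2_index [simp]:
  "mat2 a b c d $$ (0, 0) = a" "mat2 a b c d $$ (0, Suc 0) = b"
  "mat2 a b c d $$ (Suc 0, 0) = c" "mat2 a b c d $$ (Suc 0, Suc 0) = d"
  by (simp_all add: mat_of_rows_list_def)

lemma mult_2_2_index:
  fixes M N :: "complex mat"
  assumes "M \<in> carrier_mat n 2" "N \<in> carrier_mat 2 r" "i < n" "j < r"
  shows "(M * N) $$ (i, j) = M $$ (i, 0) * N $$ (0, j) + M $$ (i, Suc 0) * N $$ (Suc 0, j)"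
  using assms by (simp add: scalar_prod_def numeral_2_eq_2)

lemma mat2_eqI:
  assumes "M \<in> carrier_mat 2 2" "M $$ (0, 0) = a" "M $$ (0, Suc 0) = b"
    "M $$ (Suc 0, 0) = c" "M $$ (Suc 0, Suc 0) = d"
  shows "M = mat2 a b c d"
  using assms by (intro eq_matI) (auto simp: less_2_cases_iff)

lemma mat2_mult:
  "mat2 a b c d * mat2 a' b' c' d' = mat2 (a * a' + b * c') (a * b' + b * d') (c * a' + d * c') (c * b' + d * d')"
  by (intro mat2_eqI) (simp_all add: mult_2_2_index[where n = 2 and r = 2] mult_carrier_mat[where n = 2]
      del: index_mult_mat(1))

lemma mat2_1: "mat2 1 0 0 1 = 1\<^sub>m 2"
  by (rule mat2_eqI[symmetric]) auto

lemma mat2_mult_vec: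
  assumes "w \<in> carrier_vec 2"
  shows "(mat2 a b c d *\<^sub>v w) $ 0 = a * w $ 0 + b * w $ Suc 0"
    and "(mat2 a b c d *\<^sub>v w) $ Suc 0 = c * w $ 0 + d * w $ Suc 0"
  using assms by (simp_all add: mat_of_rows_list_def scalar_prod_def numeral_2_eq_2)

lemma vec2_eqI:
  fixes v w :: "complex vec"
  assumes "v \<in> carrier_vec 2" "w \<in> carrier_vec 2" "v $ 0 = w $ 0" "v $ Suc 0 = w $ Suc 0"
  shows "v = w"
  using assms by (intro eq_vecI) (auto simp: less_2_cases_iff)

lemma mat_of_cols_mult_mat2:
  assumes "v \<in> carrier_vec n" "w \<in> carrier_vec n"
  shows "mat_of_cols n [v, w] * mat2 a b c d = mat_of_cols n [a \<cdot>\<^sub>v v + c \<cdot>\<^sub>v w, b \<cdot>\<^sub>v v + d \<cdot>\<^sub>v w]"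
proof -
  have Q: "mat_of_cols n [v, w] \<in> carrier_mat n 2" by (rule carrier_matI) simp_all
  show ?thesis
  proof (rule eq_matI)
    fix i j assume "i < dim_row (mat_of_cols n [a \<cdot>\<^sub>v v + c \<cdot>\<^sub>v w, b \<cdot>\<^sub>v v + d \<cdot>\<^sub>v w])"
      "j < dim_col (mat_of_cols n [a \<cdot>\<^sub>v v + c \<cdot>\<^sub>v w, b \<cdot>\<^sub>v v + d \<cdot>\<^sub>v w])"
    then have ij: "i < n" "j = 0 \<or> j = Suc 0" by auto
    then show "(mat_of_cols n [v, w] * mat2 a b c d) $$ (i, j) =
        mat_of_cols n [a \<cdot>\<^sub>v v + c \<cdot>\<^sub>v w, b \<cdot>\<^sub>v v + d \<cdot>\<^sub>v w] $$ (i, j)"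
      using assms by (auto simp: mult_2_2_index[OF Q mat2_carrier] mat_of_cols_index mult.commute
          simp del: index_mult_mat(1))
  qed auto
qed

lemma (in group) equiv_rep_of_eigenvector':
  assumes \<sigma>: "is_irrep G n \<sigma>" and \<rho>: "is_rep G 1 \<rho>"
    and v: "v \<in> carrier_vec n" "v \<noteq> 0\<^sub>v n"
    and ev: "\<And>g. g \<in> carrier G \<Longrightarrow> \<sigma> g *\<^sub>v v = entry1 (\<rho> g) \<cdot>\<^sub>v v"
  shows "equiv_rep G \<sigma> \<rho>"
proof -
  have n: "n = 1" and e: "equiv_rep G \<sigma> (\<lambda>g. mat1 (entry1 (\<rho> g)))"
    using equiv_rep_of_eigenvector[OF \<sigma> is_rep_1_char[OF \<rho>] v ev] by blast+
  have "is_rep G 1 \<sigma>" using \<sigma> n by (simp add: is_irrep_def)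
  then show ?thesis
    using e \<rho> equiv_rep_1_iff mat1_entry1[OF is_rep_carrier[OF \<rho>]] by simp
qed

section \<open>Representations of the extension built from characters of \<open>A\<close>\<close>

context involutive_extension
begin

lemma is_char_f: "is_char A \<chi> \<Longrightarrow> is_char A (\<lambda>a. \<chi> (f a))"
  using hom_one[OF f_hom is_group is_group] by (simp add: is_char_def f_mult)

lemma rep1_exists:
  assumes \<chi>: "is_char A \<chi>" "\<And>a. a \<in> carrier A \<Longrightarrow> \<chi> (f a) = \<chi> a" and t: "t\<^sup>2 = \<chi> y"
  shows "\<exists>\<rho>. is_rep E 1 \<rho> \<and> \<rho> x = mat1 t \<and> (\<forall>a\<in>carrier A. \<rho> (\<iota> a) = mat1 (\<chi> a))"
  using t \<chi>(2)
  by (intro ext_rep_exists is_rep_mat1[OF \<chi>(1)]) (auto simp: mat1_mult power2_eq_square mult.commute)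

text \<open>The action on a basis \<open>v\<close>, \<open>x v\<close> when \<open>v\<close> has
  character \<open>\<chi>\<close>. The square of the matrix of \<open>x\<close> is
  \<open>\<chi> y\<close> times the identity, which matches the value at \<open>y\<close> because
  \<open>f y = y\<close>.\<close>

lemma rep2_exists:
  assumes \<chi>: "is_char A \<chi>"
  shows "\<exists>\<rho>. is_rep E 2 \<rho> \<and> \<rho> x = mat2 0 (\<chi> y) 1 0 \<and>
    (\<forall>a\<in>carrier A. \<rho> (\<iota> a) = mat2 (\<chi> a) 0 0 (\<chi> (f a)))"
proof (rule ext_rep_exists)
  show "is_rep A 2 (\<lambda>a. mat2 (\<chi> a) 0 0 (\<chi> (f a)))"
    using \<chi> is_char_f[OF \<chi>] by (simp add: is_rep_iff mat2_mult is_char_def mat2_1)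
qed (use \<chi> in \<open>auto simp: mat2_mult f_f mult.commute\<close>)

text \<open>The matrix at \<open>a\<close> has distinct eigenvalues, so a nonzero invariant subspace
  contains one of the coordinate axes, and \<open>x\<close> exchanges the axes up to nonzero
  scalars.\<close>

lemma rep2_irrep:
  assumes \<chi>: "is_char A \<chi>" and a: "a \<in> carrier A" "\<chi> (f a) \<noteq> \<chi> a"
    and \<rho>: "is_rep E 2 \<rho>" "\<rho> x = mat2 0 (\<chi> y) 1 0"
      "\<And>a. a \<in> carrier A \<Longrightarrow> \<rho> (\<iota> a) = mat2 (\<chi> a) 0 0 (\<chi> (f a))"
  shows "is_irrep E 2 \<rho>"
  unfolding is_irrep_def subspace_iff
proof (intro conjI allI impI \<rho>(1))
  fix W :: "complex vec set"
  assume W: "W \<subseteq> carrier_vec 2 \<and> 0\<^sub>v 2 \<in> W \<and> (\<forall>v\<in>W. \<forall>w\<in>W. v + w \<in> W) \<and> (\<forall>c. \<forall>v\<in>W. c \<cdot>\<^sub>v v \<in> W)"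
    and inv: "\<forall>g\<in>carrier E. \<forall>w\<in>W. \<rho> g *\<^sub>v w \<in> W"
  note Wc = subsetD[OF conjunct1[OF W]]
  have add: "v + w \<in> W" if "v \<in> W" "w \<in> W" for v w using W that by blast
  have smult: "c \<cdot>\<^sub>v v \<in> W" if "v \<in> W" for c v using W that by blast
  let ?e0 = "unit_vec 2 0 :: complex vec" and ?e1 = "unit_vec 2 (Suc 0) :: complex vec"
  have x0: "\<rho> x *\<^sub>v ?e0 = ?e1" unfolding \<rho>(2)
    by (rule vec2_eqI) (auto simp: mat2_mult_vec simp del: index_mult_mat_vec)
  have x1: "\<rho> x *\<^sub>v ?e1 = \<chi> y \<cdot>\<^sub>v ?e0" unfolding \<rho>(2)
    by (rule vec2_eqI) (auto simp: mat2_mult_vec simp del: index_mult_mat_vec)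
  have y: "\<chi> y \<noteq> 0" using is_char_nonzero[OF \<chi>] by simp
  show "W = {0\<^sub>v 2} \<or> W = carrier_vec 2"
  proof (cases "W \<subseteq> {0\<^sub>v 2}")
    case True
    then show ?thesis using W by blast
  next
    case False
    then obtain w where w: "w \<in> W" "w \<noteq> 0\<^sub>v 2" by blast
    note wc = Wc[OF w(1)]
    have "?e0 \<in> W \<and> ?e1 \<in> W"
    proof (cases "w $ 0 = 0")
      case False
      let ?d = "\<chi> a - \<chi> (f a)"
      \<comment> \<open>Subtracting \<open>\<chi> (f a)\<close> times \<open>w\<close> kills the
        second coordinate and leaves \<open>?d * w $ 0\<close> in the first.\<close>
      let ?u = "\<rho> (\<iota> a) *\<^sub>v w + (- \<chi> (f a)) \<cdot>\<^sub>v w"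
      have "?u \<in> W" using add smult inv w(1) a(1) by simp
      then have "inverse (?d * w $ 0) \<cdot>\<^sub>v ?u \<in> W" by (rule smult)
      moreover have "inverse (?d * w $ 0) \<cdot>\<^sub>v ?u = ?e0"
        using wc a False unfolding \<rho>(3)[OF a(1)]
        by (intro vec2_eqI) (auto simp: mat2_mult_vec field_simps simp del: index_mult_mat_vec)
      ultimately have "?e0 \<in> W" by simp
      moreover from this have "?e1 \<in> W" using inv x0 x_closed by metis
      ultimately show ?thesis by blast
    next
      case True
      have w1: "w $ Suc 0 \<noteq> 0"
      proof
        assume "w $ Suc 0 = 0"
        with True have "w = 0\<^sub>v 2" using wc by (intro vec2_eqI) auto
        with w show False by simp
      qed
      have "inverse (w $ Suc 0) \<cdot>\<^sub>v w = ?e1"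
        using True w1 wc by (intro vec2_eqI) auto
      then have e1: "?e1 \<in> W" using smult w(1) by metis
      then have "\<chi> y \<cdot>\<^sub>v ?e0 \<in> W" using inv x1 x_closed by metis
      then have "inverse (\<chi> y) \<cdot>\<^sub>v (\<chi> y \<cdot>\<^sub>v ?e0) \<in> W" by (rule smult)
      then show ?thesis using y e1 by (simp add: smult_smult_assoc)
    qed
    then have e: "?e0 \<in> W" "?e1 \<in> W" by auto
    have "u \<in> W" if u: "u \<in> carrier_vec 2" for u
    proof -
      have "u = u $ 0 \<cdot>\<^sub>v ?e0 + u $ Suc 0 \<cdot>\<^sub>v ?e1"
        using u by (intro vec2_eqI) auto
      then show ?thesis using add smult e by metis
    qed
    then show ?thesis using W by blast
  qed
qed simp

text \<open>Compare first columns in the intertwining relation for \<open>P\<close>: a nonzero entry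
  in row 0 forces the first alternative, one in row 1 the second. The first column of an invertible
  \<open>P\<close> is nonzero.\<close>

lemma rep2_equiv_imp:
  assumes \<rho>: "is_rep E 2 \<rho>" "\<And>a. a \<in> carrier A \<Longrightarrow> \<rho> (\<iota> a) = mat2 (\<chi> a) 0 0 (\<chi> (f a))"
    and \<rho>': "\<And>a. a \<in> carrier A \<Longrightarrow> \<rho>' (\<iota> a) = mat2 (\<chi>' a) 0 0 (\<chi>' (f a))"
    and e: "equiv_rep E \<rho> \<rho>'"
  shows "(\<forall>a\<in>carrier A. \<chi> a = \<chi>' a) \<or> (\<forall>a\<in>carrier A. \<chi> a = \<chi>' (f a))"
proof -
  from e obtain n P where "is_rep E n \<rho>" "P \<in> carrier (GLC n)"
    and P: "\<And>g. g \<in> carrier E \<Longrightarrow> P * \<rho> g = \<rho>' g * P" unfolding equiv_rep_def by blast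
  moreover from this have "n = 2" using \<rho>(1) E.is_rep_dim_unique by blast
  ultimately obtain Q where Pc: "P \<in> carrier_mat 2 2" and Q: "Q \<in> carrier_mat 2 2" "Q * P = 1\<^sub>m 2"
    unfolding carrier_GLC by auto
  have "Q $$ (0, 0) * P $$ (0, 0) + Q $$ (0, Suc 0) * P $$ (Suc 0, 0) = 1"
    using mult_2_2_index[OF Q(1) Pc, of 0 0] Q(2) by simp
  then have nz: "P $$ (0, 0) \<noteq> 0 \<or> P $$ (Suc 0, 0) \<noteq> 0" by auto
  have "P $$ (0, 0) * \<chi> a = \<chi>' a * P $$ (0, 0) \<and> P $$ (Suc 0, 0) * \<chi> a = \<chi>' (f a) * P $$ (Suc 0, 0)"
    if a: "a \<in> carrier A" for a
  proof -
    have eq: "P * mat2 (\<chi> a) 0 0 (\<chi> (f a)) = mat2 (\<chi>' a) 0 0 (\<chi>' (f a)) * P"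
      using P[OF \<iota>_closed[OF a]] \<rho>(2)[OF a] \<rho>'[OF a] by simp
    show ?thesis
      using arg_cong[OF eq, of "\<lambda>M. M $$ (0, 0)"] arg_cong[OF eq, of "\<lambda>M. M $$ (Suc 0, 0)"]
      by (simp add: mult_2_2_index[OF Pc mat2_carrier] mult_2_2_index[OF mat2_carrier Pc] del: index_mult_mat(1))
  qed
  then show ?thesis using nz by (metis mult.commute mult_right_cancel)
qed

text \<open>Both come from the group relations: \<open>\<iota> a\<close> times \<open>x\<close> is
  \<open>x\<close> times \<open>\<iota> (f a)\<close>, and \<open>x\<close> squared is
  \<open>\<iota> y\<close>.\<close>

lemma eigenvector_x:
  assumes \<sigma>: "is_rep E n \<sigma>" and v: "v \<in> carrier_vec n"
    and ev: "\<And>a. a \<in> carrier A \<Longrightarrow> \<sigma> (\<iota> a) *\<^sub>v v = \<chi> a \<cdot>\<^sub>v v"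
  shows "a \<in> carrier A \<Longrightarrow> \<sigma> (\<iota> a) *\<^sub>v (\<sigma> x *\<^sub>v v) = \<chi> (f a) \<cdot>\<^sub>v (\<sigma> x *\<^sub>v v)"
    and "\<sigma> x *\<^sub>v (\<sigma> x *\<^sub>v v) = \<chi> y \<cdot>\<^sub>v v"
proof -
  note c = E.is_rep_carrier[OF \<sigma>]
  have act: "\<sigma> g *\<^sub>v (\<sigma> h *\<^sub>v v) = \<sigma> (g \<otimes>\<^bsub>E\<^esub> h) *\<^sub>v v" if "g \<in> carrier E" "h \<in> carrier E" for g h
    using assoc_mult_mat_vec[OF c c v] E.is_rep_mult[OF \<sigma>] that by simp
  show "\<sigma> x *\<^sub>v (\<sigma> x *\<^sub>v v) = \<chi> y \<cdot>\<^sub>v v" by (simp add: act x_x ev)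
  show "\<sigma> (\<iota> a) *\<^sub>v (\<sigma> x *\<^sub>v v) = \<chi> (f a) \<cdot>\<^sub>v (\<sigma> x *\<^sub>v v)" if a: "a \<in> carrier A"
  proof -
    have "\<sigma> (\<iota> a) *\<^sub>v (\<sigma> x *\<^sub>v v) = \<sigma> x *\<^sub>v (\<sigma> (\<iota> (f a)) *\<^sub>v v)"
      using a x_\<iota>[of "f a"] by (simp add: act f_f)
    then show ?thesis using a ev mult_mat_vec[OF c[OF x_closed] v] by simp
  qed
qed

lemma irrep_equiv_rep1:
  assumes \<sigma>: "is_irrep E n \<sigma>" and v: "v \<in> carrier_vec n" "v \<noteq> 0\<^sub>v n"
    and ev: "\<And>a. a \<in> carrier A \<Longrightarrow> \<sigma> (\<iota> a) *\<^sub>v v = \<chi> a \<cdot>\<^sub>v v"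
    and evx: "\<sigma> x *\<^sub>v v = t \<cdot>\<^sub>v v"
    and \<rho>: "is_rep E 1 \<rho>" "\<rho> x = mat1 t" "\<And>a. a \<in> carrier A \<Longrightarrow> \<rho> (\<iota> a) = mat1 (\<chi> a)"
  shows "equiv_rep E \<sigma> \<rho>"
proof (rule E.equiv_rep_of_eigenvector'[OF \<sigma> \<rho>(1) v])
  have \<sigma>r: "is_rep E n \<sigma>" using \<sigma> by (simp add: is_irrep_def)
  note c = E.is_rep_carrier[OF \<sigma>r]
  fix g assume "g \<in> carrier E"
  then show "\<sigma> g *\<^sub>v v = entry1 (\<rho> g) \<cdot>\<^sub>v v"
  proof (cases rule: elem_cases)
    case (1 a)
    then show ?thesis using ev \<rho>(3) by simp
  next
    case (2 a)
    have "\<sigma> g *\<^sub>v v = \<sigma> x *\<^sub>v (\<sigma> (\<iota> a) *\<^sub>v v)"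
      using 2 E.is_rep_mult[OF \<sigma>r] assoc_mult_mat_vec[OF c c v(1)] by simp
    also have "\<dots> = (t * \<chi> a) \<cdot>\<^sub>v v"
      using 2 ev evx mult_mat_vec[OF c[OF x_closed] v(1)] by (simp add: smult_smult_assoc mult.commute)
    also have "t * \<chi> a = entry1 (\<rho> g)"
      using 2 E.is_rep_mult[OF \<rho>(1)] \<rho>(2,3) by (simp add: mat1_mult)
    finally show ?thesis .
  qed
qed

text \<open>The matrix with columns \<open>v\<close> and \<open>x v\<close> intertwines
  \<open>\<rho>\<close> with \<open>\<sigma>\<close>. Schur's lemma asks that it be nonzero, which
  \<open>v\<close> ensures; the independence of the two columns is then a consequence.\<close>

lemma irrep_equiv_rep2:
  assumes \<sigma>: "is_irrep E n \<sigma>" and v: "v \<in> carrier_vec n" "v \<noteq> 0\<^sub>v n"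
    and ev: "\<And>a. a \<in> carrier A \<Longrightarrow> \<sigma> (\<iota> a) *\<^sub>v v = \<chi> a \<cdot>\<^sub>v v"
    and \<rho>: "is_irrep E 2 \<rho>" "\<rho> x = mat2 0 (\<chi> y) 1 0"
      "\<And>a. a \<in> carrier A \<Longrightarrow> \<rho> (\<iota> a) = mat2 (\<chi> a) 0 0 (\<chi> (f a))"
  shows "equiv_rep E \<sigma> \<rho>"
proof -
  have r: "is_rep E n \<sigma>" "is_rep E 2 \<rho>" using \<sigma> \<rho>(1) by (auto simp: is_irrep_def)
  note c = E.is_rep_carrier[OF r(1)] and c' = E.is_rep_carrier[OF r(2)]
  let ?w = "\<sigma> x *\<^sub>v v"
  let ?Q = "mat_of_cols n [v, ?w]"
  have w: "?w \<in> carrier_vec n" using c[OF x_closed] v(1) by simp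
  have Q: "?Q \<in> carrier_mat n 2" by (rule carrier_matI) simp_all
  have "col ?Q 0 = v" using v(1) by simp
  then have Q0: "?Q \<noteq> 0\<^sub>m n 2" using v(2) by auto
  have zero: "0 \<cdot>\<^sub>v u = 0\<^sub>v n" if "u \<in> carrier_vec n" for u :: "complex vec"
    using that by (intro eq_vecI) auto
  have \<iota>Q: "\<sigma> (\<iota> a) * ?Q = ?Q * \<rho> (\<iota> a)" if a: "a \<in> carrier A" for a
  proof -
    have "\<sigma> (\<iota> a) * ?Q = mat_of_cols n [\<chi> a \<cdot>\<^sub>v v, \<chi> (f a) \<cdot>\<^sub>v ?w]"
      using mult_mat_of_cols[OF c[OF \<iota>_closed[OF a]], of "[v, ?w]"] v(1) w a
      by (simp add: ev eigenvector_x(1)[OF r(1) v(1) ev])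
    then show ?thesis using v(1) w by (simp add: \<rho>(3)[OF a] mat_of_cols_mult_mat2 zero)
  qed
  have xQ: "\<sigma> x * ?Q = ?Q * \<rho> x"
  proof -
    have "\<sigma> x * ?Q = mat_of_cols n [?w, \<chi> y \<cdot>\<^sub>v v]"
      using mult_mat_of_cols[OF c[OF x_closed], of "[v, ?w]"] v(1) w
      by (simp add: eigenvector_x(2)[OF r(1) v(1) ev])
    then show ?thesis using v(1) w by (simp add: \<rho>(2) mat_of_cols_mult_mat2 zero)
  qed
  show ?thesis
  proof (rule E.schur_equiv_rep(1)[OF \<sigma> \<rho>(1) Q Q0])
    fix g assume "g \<in> carrier E"
    then show "\<sigma> g * ?Q = ?Q * \<rho> g"
    proof (cases rule: elem_cases)
      case (1 a)
      then show ?thesis using \<iota>Q by simp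
    next
      case (2 a)
      note a = \<iota>_closed[OF 2(1)]
      have "\<sigma> g * ?Q = \<sigma> x * (\<sigma> (\<iota> a) * ?Q)"
        using 2 E.is_rep_mult[OF r(1)] assoc_mult_mat[OF c[OF x_closed] c[OF a] Q] by simp
      also have "\<dots> = (\<sigma> x * ?Q) * \<rho> (\<iota> a)"
        using \<iota>Q[OF 2(1)] assoc_mult_mat[OF c[OF x_closed] Q c'[OF a]] by simp
      also have "\<dots> = ?Q * \<rho> g"
        using 2 xQ E.is_rep_mult[OF r(2)] assoc_mult_mat[OF Q c'[OF x_closed] c'[OF a]] by simp
      finally show ?thesis .
    qed
  qed
qed

end

section \<open>Classification\<close>

text \<open>Each two-element orbit is represented by its member with the smaller code under an
  injection into the naturals. Listing the representatives first and then their images in the same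
  order produces the shift by half.\<close>

lemma enumerate_fixpoint_free_involution:
  assumes fin: "finite X" and \<tau>: "\<And>z. z \<in> X \<Longrightarrow> \<tau> z \<in> X" "\<And>z. z \<in> X \<Longrightarrow> \<tau> (\<tau> z) = z"
    "\<And>z. z \<in> X \<Longrightarrow> \<tau> z \<noteq> z"
  shows "even (card X)"
    and "\<exists>g. bij_betw g {1..card X} X \<and> (\<forall>j\<in>{1..card X div 2}. g (j + card X div 2) = \<tau> (g j))"
proof -
  obtain e :: "'a \<Rightarrow> nat" where e: "inj_on e X"
    using finite_imp_inj_to_nat_seg[OF fin] by blast
  define T where "T = {z \<in> X. e z < e (\<tau> z)}"
  have finT: "finite T" using fin by (simp add: T_def)
  have inj: "inj_on \<tau> T" using \<tau>(2) by (intro inj_onI) (metis (mono_tags, lifting) T_def mem_Collect_eq)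
  have disj: "T \<inter> \<tau> ` T = {}" using \<tau>(2) by (auto simp: T_def)
  have X: "X = T \<union> \<tau> ` T"
  proof
    show "X \<subseteq> T \<union> \<tau> ` T"
    proof
      fix z assume z: "z \<in> X"
      have "e z \<noteq> e (\<tau> z)" using inj_onD[OF e _ z \<tau>(1)[OF z]] \<tau>(3)[OF z] by metis
      then consider "e z < e (\<tau> z)" | "e (\<tau> z) < e z" by linarith
      then show "z \<in> T \<union> \<tau> ` T"
      proof cases
        case 2
        then have "\<tau> z \<in> T" using z \<tau> by (simp add: T_def)
        then show ?thesis using \<tau>(2)[OF z] by (metis UnI2 imageI)
      qed (use z in \<open>simp add: T_def\<close>)
    qed
  qed (use \<tau>(1) in \<open>auto simp: T_def\<close>)
  define m where "m = card T"
  have card: "card X = 2 * m"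
    using card_Un_disjoint[OF finT finite_imageI[OF finT, of \<tau>] disj] card_image[OF inj] X
    by (simp add: m_def)
  then show "even (card X)" by simp
  obtain h where h: "bij_betw h {1..m} T"
    using finite_same_card_bij[of "{1..m}" T] finT by (auto simp: m_def)
  define g where "g j = (if j \<le> m then h j else \<tau> (h (j - m)))" for j
  have "bij_betw g {1..m} T" using h by (subst bij_betw_cong[of _ _ h]) (auto simp: g_def)
  moreover have "bij_betw (\<tau> \<circ> (h \<circ> (\<lambda>j. j - m))) {m + 1..2 * m} (\<tau> ` T)"
  proof (intro bij_betw_trans)
    show "bij_betw (\<lambda>j. j - m) {m + 1..2 * m} {1..m}"
      by (rule bij_betwI[where g = "\<lambda>j. j + m"]) auto
  qed (use h inj in \<open>auto simp: bij_betw_def\<close>)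
  then have "bij_betw g {m + 1..2 * m} (\<tau> ` T)"
    by (subst bij_betw_cong[of _ _ "\<tau> \<circ> (h \<circ> (\<lambda>j. j - m))"]) (auto simp: g_def)
  ultimately have "bij_betw g ({1..m} \<union> {m + 1..2 * m}) (T \<union> \<tau> ` T)"
    using disj by (rule bij_betw_combine)
  moreover have "{1..m} \<union> {m + 1..2 * m} = {1..2 * m}" by auto
  moreover have "g (j + m) = \<tau> (g j)" if "j \<in> {1..m}" for j using that by (simp add: g_def)
  ultimately show "\<exists>g. bij_betw g {1..card X} X \<and> (\<forall>j\<in>{1..card X div 2}. g (j + card X div 2) = \<tau> (g j))"
    using X card by (intro exI[of _ g]) auto
qed

section \<open>The subgroup \<open>B\<close>, its quotient, and the two kinds of characters of
  \<open>A\<close>\<close>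

context involutive_extension
begin

definition B where "B = {f a \<otimes> inv a | a. a \<in> carrier A}"

lemma B_subset: "B \<subseteq> carrier A"
  by (auto simp: B_def)

lemma char_trivial_on_B_iff:
  assumes "is_char A \<chi>"
  shows "(\<forall>b\<in>B. \<chi> b = 1) \<longleftrightarrow> (\<forall>a\<in>carrier A. \<chi> (f a) = \<chi> a)"
proof -
  have "\<chi> (f a \<otimes> inv a) = 1 \<longleftrightarrow> \<chi> (f a) = \<chi> a" if "a \<in> carrier A" for a
    using assms that is_char_nonzero[OF assms that] by (simp add: is_char_mult is_char_inv field_simps)
  then show ?thesis unfolding B_def by blast
qed

text \<open>\<open>B\<close> is the image of the map sending \<open>a\<close> to
  \<open>f a \<otimes> inv a\<close>, which is multiplicative because \<open>A\<close> is
  commutative.\<close>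

lemma subgroup_B: "subgroup B A"
proof
  have f1: "f \<one> = \<one>" using hom_one[OF f_hom is_group is_group] .
  have finv: "f (inv a) = inv (f a)" if "a \<in> carrier A" for a
    using that f_mult[of "inv a" a] f1 by (intro inv_equality[symmetric]) auto
  show "B \<subseteq> carrier A" by (rule B_subset)
  show "\<one> \<in> B" using f1 by (auto simp: B_def intro!: exI[of _ \<one>])
  show "b \<otimes> b' \<in> B" if "b \<in> B" "b' \<in> B" for b b'
  proof -
    from that obtain a a' where "a \<in> carrier A" "a' \<in> carrier A" "b = f a \<otimes> inv a" "b' = f a' \<otimes> inv a'"
      by (auto simp: B_def)
    then show ?thesis
      by (auto simp: B_def f_mult inv_mult m_ac intro!: exI[of _ "a \<otimes> a'"])
  qed
  show "inv b \<in> B" if "b \<in> B" for b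
  proof -
    from that obtain a where "a \<in> carrier A" "b = f a \<otimes> inv a" by (auto simp: B_def)
    then show ?thesis
      by (auto simp: B_def finv inv_mult intro!: exI[of _ "inv a"])
  qed
qed

lemma normal_B: "B \<lhd> A"
  by (rule subgroup_imp_normal[OF subgroup_B])

sublocale Q: comm_group "A Mod B"
  by (rule abelian_FactGroup[OF subgroup_B])

lemma finite_Q: "finite (carrier (A Mod B))"
  using fin rcosets_finite[OF _ B_subset] unfolding FactGroup_def RCOSETS_def by simp

lemma coset_closed: "a \<in> carrier A \<Longrightarrow> B #> a \<in> carrier (A Mod B)"
  by (auto simp: FactGroup_def RCOSETS_def)

lemma coset_mult:
  "a \<in> carrier A \<Longrightarrow> b \<in> carrier A \<Longrightarrow> B #> (a \<otimes> b) = (B #> a) \<otimes>\<^bsub>A Mod B\<^esub> (B #> b)"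
  using normal.rcos_sum[OF normal_B] by (simp add: FactGroup_def)

lemma coset_cases:
  assumes "C \<in> carrier (A Mod B)"
  obtains a where "a \<in> carrier A" "C = B #> a"
  using assms by (auto simp: FactGroup_def RCOSETS_def)

lemma coset_one: "B #> \<one> = \<one>\<^bsub>A Mod B\<^esub>"
  using coset_mult_one[OF B_subset] by (simp add: FactGroup_def)

lemma coset_of_B: "b \<in> B \<Longrightarrow> B #> b = B #> \<one>"
  using coset_join2[OF _ subgroup_B] coset_mult_one[OF B_subset] B_subset by auto

lemma is_char_coset: "is_char (A Mod B) \<chi> \<Longrightarrow> is_char A (\<lambda>a. \<chi> (B #> a))"
  by (simp add: is_char_def coset_one coset_mult coset_closed)

text \<open>Triviality on \<open>B\<close> makes the value independent of the representative chosen
  from a coset.\<close>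

lemma char_factors:
  assumes \<chi>: "is_char A \<chi>" and triv: "\<forall>b\<in>B. \<chi> b = 1"
  shows "\<exists>\<chi>'. is_char (A Mod B) \<chi>' \<and> (\<forall>a\<in>carrier A. \<chi>' (B #> a) = \<chi> a)"
proof -
  define \<chi>' where "\<chi>' C = \<chi> (SOME c. c \<in> C)" for C
  have \<chi>': "\<chi>' (B #> a) = \<chi> a" if a: "a \<in> carrier A" for a
  proof -
    have "(SOME c. c \<in> B #> a) \<in> B #> a" using rcos_self[OF a subgroup_B] by (rule someI)
    then obtain b where "b \<in> B" "(SOME c. c \<in> B #> a) = b \<otimes> a" by (auto simp: r_coset_def)
    then show ?thesis using a triv B_subset by (auto simp: \<chi>'_def is_char_mult[OF \<chi>])
  qed
  have "is_char (A Mod B) \<chi>'"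
    unfolding is_char_def
  proof (intro conjI ballI)
    show "\<chi>' \<one>\<^bsub>A Mod B\<^esub> = 1" using \<chi>'[OF one_closed] is_char_one[OF \<chi>] by (simp add: coset_one)
    fix C D assume "C \<in> carrier (A Mod B)" "D \<in> carrier (A Mod B)"
    then obtain c d where "c \<in> carrier A" "d \<in> carrier A" "C = B #> c" "D = B #> d"
      by (metis coset_cases)
    then show "\<chi>' (C \<otimes>\<^bsub>A Mod B\<^esub> D) = \<chi>' C * \<chi>' D"
      using coset_mult[of c d] \<chi>'[of "c \<otimes> d"] \<chi>' is_char_mult[OF \<chi>] by (metis m_closed)
  qed
  then show ?thesis using \<chi>' by blast
qed

text \<open>Inflation from the quotient is a bijection onto the characters trivial on
  \<open>B\<close>; this is where the index enters the count.\<close>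

lemma card_chars_trivial:
  "card {\<chi> \<in> chars A. \<forall>b\<in>B. \<chi> b = 1} = Coset.order (A Mod B)"
proof -
  define \<theta> where "\<theta> \<chi> = (\<lambda>a\<in>carrier A. \<chi> (B #> a))" for \<chi> :: "'a set \<Rightarrow> complex"
  have "bij_betw \<theta> (chars (A Mod B)) {\<chi> \<in> chars A. \<forall>b\<in>B. \<chi> b = 1}"
    unfolding bij_betw_def
  proof
    show "inj_on \<theta> (chars (A Mod B))"
    proof (rule inj_onI)
      fix \<chi> \<chi>' assume *: "\<chi> \<in> chars (A Mod B)" "\<chi>' \<in> chars (A Mod B)" "\<theta> \<chi> = \<theta> \<chi>'"
      show "\<chi> = \<chi>'"
      proof (rule extensionalityI)
        fix C assume "C \<in> carrier (A Mod B)"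
        then obtain a where "a \<in> carrier A" "C = B #> a" by (rule coset_cases)
        then show "\<chi> C = \<chi>' C" using fun_cong[OF *(3), of a] by (simp add: \<theta>_def)
      qed (use * in \<open>auto simp: chars_def\<close>)
    qed
    show "\<theta> ` chars (A Mod B) = {\<chi> \<in> chars A. \<forall>b\<in>B. \<chi> b = 1}"
    proof (intro Set.set_eqI iffI)
      fix \<chi> assume "\<chi> \<in> \<theta> ` chars (A Mod B)"
      then obtain \<chi>' where \<chi>': "is_char (A Mod B) \<chi>'" "\<chi> = \<theta> \<chi>'" by (auto simp: chars_def)
      then have "\<chi> \<in> chars A" using is_char_restrict[OF is_char_coset] by (simp add: \<theta>_def)
      moreover have "\<chi> b = 1" if "b \<in> B" for b
        using that B_subset \<chi>' is_char_one[OF \<chi>'(1)] by (auto simp: \<theta>_def coset_of_B coset_one)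
      ultimately show "\<chi> \<in> {\<chi> \<in> chars A. \<forall>b\<in>B. \<chi> b = 1}" by blast
    next
      fix \<chi> assume \<chi>: "\<chi> \<in> {\<chi> \<in> chars A. \<forall>b\<in>B. \<chi> b = 1}"
      then obtain \<chi>' where \<chi>': "is_char (A Mod B) \<chi>'" "\<forall>a\<in>carrier A. \<chi>' (B #> a) = \<chi> a"
        using char_factors[of \<chi>] by (auto simp: chars_def)
      have "\<chi> = \<theta> (restrict \<chi>' (carrier (A Mod B)))"
        using \<chi> \<chi>'(2) by (intro extensionalityI) (auto simp: chars_def \<theta>_def coset_closed)
      then show "\<chi> \<in> \<theta> ` chars (A Mod B)"
        using Q.is_char_restrict[OF \<chi>'(1)] by blast
    qed
  qed
  from bij_betw_same_card[OF this] show ?thesis using Q.card_chars[OF finite_Q] by simp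
qed

text \<open>Parity and the pairing of the two halves both come from the twist by \<open>f\<close>,
  which has no fixed point among the characters nontrivial on \<open>B\<close>. They are the
  complement of the inflated ones, so the subtraction in \<open>N\<close> is a true
  difference.\<close>

lemma nontrivial_chars_enumeration:
  defines "N \<equiv> card (carrier A) - Coset.order (A Mod B)"
  shows "even N"
    and "\<exists>\<psi>. enumerates_reps A (irreps_ker_not_containing A B) N \<psi> \<and>
      (\<forall>j\<in>{1..N div 2}. \<forall>a\<in>carrier A. \<psi> (j + N div 2) a = \<psi> j (f a))"
proof -
  define X where "X = {\<chi> \<in> chars A. \<exists>b\<in>B. \<chi> b \<noteq> 1}"
  define \<tau> where "\<tau> \<chi> = (\<lambda>a\<in>carrier A. \<chi> (f a))" for \<chi> :: "'a \<Rightarrow> complex"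
  have X_iff: "\<chi> \<in> X \<longleftrightarrow> \<chi> \<in> extensional (carrier A) \<and> is_char A \<chi> \<and> \<not> (\<forall>a\<in>carrier A. \<chi> (f a) = \<chi> a)" for \<chi>
    using char_trivial_on_B_iff[of \<chi>] by (auto simp: X_def chars_def)
  have finX: "finite X" using finite_chars[OF fin] by (simp add: X_def)
  have "X = chars A - {\<chi> \<in> chars A. \<forall>b\<in>B. \<chi> b = 1}" by (auto simp: X_def)
  then have card: "card X = N"
    using card_Diff_subset[of "{\<chi> \<in> chars A. \<forall>b\<in>B. \<chi> b = 1}" "chars A"] finite_chars[OF fin]
    by (simp add: card_chars_trivial card_chars[OF fin] N_def Coset.order_def)
  \<comment> \<open>If \<open>\<chi>\<close> and \<open>\<chi> \<circ> f\<close> differ at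
    \<open>a\<close>, so do \<open>\<chi> \<circ> f\<close> and its own twist, since twisting twice
    gives back \<open>\<chi>\<close>.\<close>
  have \<tau>1: "\<tau> \<chi> \<in> X" if "\<chi> \<in> X" for \<chi>
    using that is_char_restrict[OF is_char_f, of \<chi>] unfolding X_iff chars_def \<tau>_def
    by (auto simp: f_f) (metis f_f f_closed)
  have \<tau>2: "\<tau> (\<tau> \<chi>) = \<chi>" if "\<chi> \<in> X" for \<chi>
    using that unfolding X_iff \<tau>_def by (intro extensionalityI) (auto simp: f_f)
  have \<tau>3: "\<tau> \<chi> \<noteq> \<chi>" if "\<chi> \<in> X" for \<chi>
    using that unfolding X_iff \<tau>_def by (metis restrict_apply')
  show "even N" using enumerate_fixpoint_free_involution(1)[OF finX \<tau>1 \<tau>2 \<tau>3] card by simp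
  obtain g where g: "bij_betw g {1..N} X" "\<forall>j\<in>{1..N div 2}. g (j + N div 2) = \<tau> (g j)"
    using enumerate_fixpoint_free_involution(2)[OF finX \<tau>1 \<tau>2 \<tau>3] card by auto
  have "{\<sigma>. is_rep A 1 \<sigma> \<and> (\<lambda>a\<in>carrier A. entry1 (\<sigma> a)) \<in> X} = irreps_ker_not_containing A B"
    unfolding irreps_ker_not_containing_eq[OF fin B_subset] X_def
    using is_char_restrict[OF is_rep_1_char] B_subset by auto
  then have "enumerates_reps A (irreps_ker_not_containing A B) N (\<lambda>j a. mat1 (g j a))"
    using enumerates_reps_mat1[OF g(1)] by (simp add: X_def)
  moreover have "mat1 (g (j + N div 2) a) = mat1 (g j (f a))" if "j \<in> {1..N div 2}" "a \<in> carrier A" for j a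
    using g(2) that by (simp add: \<tau>_def)
  ultimately show "\<exists>\<psi>. enumerates_reps A (irreps_ker_not_containing A B) N \<psi> \<and>
      (\<forall>j\<in>{1..N div 2}. \<forall>a\<in>carrier A. \<psi> (j + N div 2) a = \<psi> j (f a))"
    by blast
qed

text \<open>Stated with scalar functions so that cosets and 1 by 1 matrices stay outside:
  \<open>p\<close> lists the \<open>f\<close>-invariant characters, \<open>q\<close> the others,
  with twisted partners \<open>m\<close> places apart; one member of each pair yields a
  two-dimensional representation.\<close>

lemma classification:
  fixes p q :: "nat \<Rightarrow> 'a \<Rightarrow> complex" and s :: "nat \<Rightarrow> complex"
  assumes p: "\<And>j. j \<in> {1..k} \<Longrightarrow> is_char A (p j)"
      "\<And>j a. j \<in> {1..k} \<Longrightarrow> a \<in> carrier A \<Longrightarrow> p j (f a) = p j a"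
      "\<And>i j. i \<in> {1..k} \<Longrightarrow> j \<in> {1..k} \<Longrightarrow> \<forall>a\<in>carrier A. p i a = p j a \<Longrightarrow> i = j"
      "\<And>\<chi>. is_char A \<chi> \<Longrightarrow> \<forall>a\<in>carrier A. \<chi> (f a) = \<chi> a \<Longrightarrow> \<exists>j\<in>{1..k}. \<forall>a\<in>carrier A. \<chi> a = p j a"
    and s: "\<And>j. j \<in> {1..k} \<Longrightarrow> (s j)\<^sup>2 = p j y"
    and q: "\<And>j. j \<in> {1..2*m} \<Longrightarrow> is_char A (q j)"
      "\<And>j. j \<in> {1..2*m} \<Longrightarrow> \<exists>a\<in>carrier A. q j (f a) \<noteq> q j a"
      "\<And>i j. i \<in> {1..2*m} \<Longrightarrow> j \<in> {1..2*m} \<Longrightarrow> \<forall>a\<in>carrier A. q i a = q j a \<Longrightarrow> i = j"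
      "\<And>\<chi>. is_char A \<chi> \<Longrightarrow> \<exists>a\<in>carrier A. \<chi> (f a) \<noteq> \<chi> a \<Longrightarrow> \<exists>j\<in>{1..2*m}. \<forall>a\<in>carrier A. \<chi> a = q j a"
      "\<And>j a. j \<in> {1..m} \<Longrightarrow> a \<in> carrier A \<Longrightarrow> q (j + m) a = q j (f a)"
  shows "\<exists>\<rho>. enumerates_reps E (irreps E) (2 * k + m) \<rho> \<and>
    (\<forall>j\<in>{1..k}. is_rep E 1 (\<rho> j) \<and> is_rep E 1 (\<rho> (j + k)) \<and>
       \<rho> j x = mat1 (s j) \<and> \<rho> (j + k) x = mat1 (- s j) \<and>
       (\<forall>a\<in>carrier A. \<rho> j (\<iota> a) = mat1 (p j a) \<and> \<rho> (j + k) (\<iota> a) = mat1 (p j a))) \<and>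
    (\<forall>j\<in>{1..m}. \<forall>a\<in>carrier A.
       \<rho> (2 * k + j) (\<iota> a) = mat2 (q j a) 0 0 (q j (f a)) \<and>
       \<rho> (2 * k + j) (x \<otimes>\<^bsub>E\<^esub> \<iota> a) = mat2 0 (q j (y \<otimes> f a)) (q j a) 0)"
proof -
  \<comment> \<open>Indices up to \<open>k\<close> carry the root \<open>s j\<close>, those from
    \<open>k + 1\<close> to \<open>2 * k\<close> the root \<open>- s j\<close> for the same
    character, so that all one-dimensional representations are handled at once.\<close>
  define p' where "p' i = (if i \<le> k then p i else p (i - k))" for i
  define t where "t i = (if i \<le> k then s i else - s (i - k))" for i
  have ik: "(if i \<le> k then i else i - k) \<in> {1..k}" if "i \<in> {1..2*k}" for i using that by auto
  have p': "is_char A (p' i)" "\<And>a. a \<in> carrier A \<Longrightarrow> p' i (f a) = p' i a" "(t i)\<^sup>2 = p' i y"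
    if "i \<in> {1..2*k}" for i
    using p(1,2)[OF ik[OF that]] s[OF ik[OF that]] by (auto simp: p'_def t_def split: if_splits)
  have "\<forall>i\<in>{1..2*k}. \<exists>\<rho>. is_rep E 1 \<rho> \<and> \<rho> x = mat1 (t i) \<and> (\<forall>a\<in>carrier A. \<rho> (\<iota> a) = mat1 (p' i a))"
    using rep1_exists[OF p'] by blast
  then obtain R where R: "\<And>i. i \<in> {1..2*k} \<Longrightarrow> is_rep E 1 (R i)"
    "\<And>i. i \<in> {1..2*k} \<Longrightarrow> R i x = mat1 (t i)"
    "\<And>i a. i \<in> {1..2*k} \<Longrightarrow> a \<in> carrier A \<Longrightarrow> R i (\<iota> a) = mat1 (p' i a)" by metis
  have qm: "is_char A (q j)" if "j \<in> {1..m}" for j using q(1)[of j] that by auto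
  have "\<forall>j\<in>{1..m}. \<exists>\<rho>. is_rep E 2 \<rho> \<and> \<rho> x = mat2 0 (q j y) 1 0 \<and>
    (\<forall>a\<in>carrier A. \<rho> (\<iota> a) = mat2 (q j a) 0 0 (q j (f a)))"
    using rep2_exists[OF qm] by blast
  then obtain S where S: "\<And>j. j \<in> {1..m} \<Longrightarrow> is_rep E 2 (S j)"
    "\<And>j. j \<in> {1..m} \<Longrightarrow> S j x = mat2 0 (q j y) 1 0"
    "\<And>j a. j \<in> {1..m} \<Longrightarrow> a \<in> carrier A \<Longrightarrow> S j (\<iota> a) = mat2 (q j a) 0 0 (q j (f a))" by metis
  have S_irrep: "is_irrep E 2 (S j)" if j: "j \<in> {1..m}" for j
  proof -
    obtain a where "a \<in> carrier A" "q j (f a) \<noteq> q j a" using q(2)[of j] j by auto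
    then show ?thesis using rep2_irrep[OF qm[OF j]] S[OF j] by blast
  qed
  define \<rho> where "\<rho> i = (if i \<le> 2 * k then R i else S (i - 2 * k))" for i
  have \<rho>R: "\<rho> i = R i" if "i \<in> {1..2*k}" for i using that by (simp add: \<rho>_def)
  have \<rho>S: "\<rho> (2 * k + j) = S j" if "j \<in> {1..m}" for j using that by (simp add: \<rho>_def)
  have index_cases: "i \<in> {1..2*k} \<or> (\<exists>j\<in>{1..m}. i = 2 * k + j)" if "i \<in> {1..2 * k + m}" for i
  proof (cases "i \<le> 2 * k")
    case False
    then show ?thesis using that by (intro disjI2 bexI[of _ "i - 2 * k"]) auto
  qed (use that in auto)
  have R_inj: "\<not> equiv_rep E (R i) (R j)" if i: "i \<in> {1..2*k}" and j: "j \<in> {1..2*k}" and ij: "i \<noteq> j" for i j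
  proof
    assume "equiv_rep E (R i) (R j)"
    then have eq: "\<forall>g\<in>carrier E. R j g = R i g" using E.equiv_rep_1_iff[OF R(1)[OF i]] by simp
    have "\<forall>a\<in>carrier A. p' i a = p' j a" using eq R(3)[OF i] R(3)[OF j] by auto
    then have idx: "(if i \<le> k then i else i - k) = (if j \<le> k then j else j - k)"
      using p(3)[OF ik[OF i] ik[OF j]] by (auto simp: p'_def split: if_splits)
    have "t i = t j" using eq R(2)[OF i] R(2)[OF j] x_closed by (metis entry1_mat1)
    \<comment> \<open>Distinct indices with the same character are \<open>k\<close> apart and carry
      opposite roots; if these also agreed, the root and with it the value at \<open>y\<close> would
      be zero.\<close>
    moreover have "t i = - t j" using idx ij i j by (auto simp: t_def split: if_splits)
    ultimately have "t i = 0" by simp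
    then have "p' i y = 0" using p'(3)[OF i] by simp
    then show False using is_char_nonzero[OF p'(1)[OF i] y_closed] by simp
  qed
  have S_inj: "\<not> equiv_rep E (S i) (S j)" if i: "i \<in> {1..m}" and j: "j \<in> {1..m}" and ij: "i \<noteq> j" for i j
  proof
    assume "equiv_rep E (S i) (S j)"
    from rep2_equiv_imp[OF S(1)[OF i] S(3)[OF i] S(3)[OF j] this]
    have "(\<forall>a\<in>carrier A. q i a = q j a) \<or> (\<forall>a\<in>carrier A. q i a = q (j + m) a)"
      using q(5)[OF j] by auto
    \<comment> \<open>The second case would be the twisted partner of \<open>j\<close>, whose index
      exceeds \<open>m\<close>.\<close>
    then have "i = j \<or> i = j + m" using q(3)[of i j] q(3)[of i "j + m"] i j by auto
    then show False using ij i j by auto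
  qed
  have RS: "\<not> equiv_rep E (R i) (S j)" "\<not> equiv_rep E (S j) (R i)"
    if i: "i \<in> {1..2*k}" and j: "j \<in> {1..m}" for i j
    using E.equiv_rep_dim E.is_rep_dim_unique R(1)[OF i] S(1)[OF j] by (metis one_eq_numeral_iff semiring_norm(85))+
  have complete: "\<exists>i\<in>{1..2 * k + m}. equiv_rep E \<sigma> (\<rho> i)" if "\<sigma> \<in> irreps E" for \<sigma>
  proof -
    from that obtain n where \<sigma>: "is_irrep E n \<sigma>" by (auto simp: irreps_def)
    then have r: "is_rep E n \<sigma>" and n: "n > 0" by (auto simp: is_irrep_def)
    from common_eigenvector[OF fin is_rep_compose_hom[OF r \<iota>_hom] n]
    obtain v \<chi> where v: "v \<in> carrier_vec n" "v \<noteq> 0\<^sub>v n" and \<chi>: "is_char A \<chi>"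
      and ev: "\<And>a. a \<in> carrier A \<Longrightarrow> \<sigma> (\<iota> a) *\<^sub>v v = \<chi> a \<cdot>\<^sub>v v" by (auto simp: chars_def)
    let ?w = "\<sigma> x *\<^sub>v v"
    note c = E.is_rep_carrier[OF r]
    have w: "?w \<in> carrier_vec n" using c[OF x_closed] v(1) by simp
    have evx: "\<sigma> (\<iota> a) *\<^sub>v ?w = \<chi> (f a) \<cdot>\<^sub>v ?w" if "a \<in> carrier A" for a
      using eigenvector_x(1)[OF r v(1) ev that] .
    \<comment> \<open>Used with \<open>u = x v\<close> and \<open>d = s j\<close>:
      \<open>lin1\<close> collects the action of \<open>A\<close> on \<open>x v + s j v\<close>, and
      \<open>lin2\<close> that of \<open>x\<close>, once \<open>x\<^sup>2 v\<close> is replaced by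
      \<open>(s j)\<^sup>2 v\<close>.\<close>
    have lin1: "c \<cdot>\<^sub>v u + d \<cdot>\<^sub>v (c \<cdot>\<^sub>v v) = c \<cdot>\<^sub>v (u + d \<cdot>\<^sub>v v)"
      and lin2: "d\<^sup>2 \<cdot>\<^sub>v v + d \<cdot>\<^sub>v u = d \<cdot>\<^sub>v (u + d \<cdot>\<^sub>v v)"
      if "u \<in> carrier_vec n" for u c d
      using that v(1) by (auto intro!: eq_vecI simp: algebra_simps power2_eq_square)
    have xw: "\<sigma> x *\<^sub>v ?w = \<chi> y \<cdot>\<^sub>v v" using eigenvector_x(2)[OF r v(1) ev] .
    show ?thesis
    proof (cases "\<forall>a\<in>carrier A. \<chi> (f a) = \<chi> a")
      case True
      from p(4)[OF \<chi> True] obtain j where j: "j \<in> {1..k}" "\<forall>a\<in>carrier A. \<chi> a = p j a" by blast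
      let ?u = "?w + s j \<cdot>\<^sub>v v"
      have u: "?u \<in> carrier_vec n" using w v(1) by simp
      show ?thesis
      proof (cases "?u = 0\<^sub>v n")
        case u0: False
        have evu: "\<sigma> (\<iota> a) *\<^sub>v ?u = p j a \<cdot>\<^sub>v ?u" if a: "a \<in> carrier A" for a
        proof -
          have "\<sigma> (\<iota> a) *\<^sub>v ?u = \<sigma> (\<iota> a) *\<^sub>v ?w + s j \<cdot>\<^sub>v (\<sigma> (\<iota> a) *\<^sub>v v)"
            using mult_add_distrib_mat_vec[OF c[OF \<iota>_closed[OF a]] w, of "s j \<cdot>\<^sub>v v"] v(1)
              mult_mat_vec[OF c[OF \<iota>_closed[OF a]] v(1)] by simp
          also have "\<dots> = p j a \<cdot>\<^sub>v ?w + s j \<cdot>\<^sub>v (p j a \<cdot>\<^sub>v v)"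
            using evx[OF a] ev[OF a] True j(2) a by simp
          also have "\<dots> = p j a \<cdot>\<^sub>v ?u"
            by (rule lin1[OF w])
          finally show ?thesis .
        qed
        have "\<sigma> x *\<^sub>v ?u = \<sigma> x *\<^sub>v ?w + s j \<cdot>\<^sub>v ?w"
          using mult_add_distrib_mat_vec[OF c[OF x_closed] w, of "s j \<cdot>\<^sub>v v"] v(1)
            mult_mat_vec[OF c[OF x_closed] v(1)] by simp
        also have "\<dots> = (s j)\<^sup>2 \<cdot>\<^sub>v v + s j \<cdot>\<^sub>v ?w" using xw j s by simp
        also have "\<dots> = s j \<cdot>\<^sub>v ?u"
          by (rule lin2[OF w])
        finally have xu: "\<sigma> x *\<^sub>v ?u = s j \<cdot>\<^sub>v ?u" .
        have "j \<in> {1..2*k}" using j by auto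
        then have "equiv_rep E \<sigma> (R j)"
          using j(1) R(1)[of j] R(2)[of j] R(3)[of j] xu
          by (intro irrep_equiv_rep1[OF \<sigma> u u0 evu, of "s j"]) (auto simp: t_def p'_def)
        then show ?thesis using j(1) \<rho>R[of j] by (intro bexI[of _ j]) auto
      next
        case u0: True
        have xv: "\<sigma> x *\<^sub>v v = (- s j) \<cdot>\<^sub>v v"
        proof (rule eq_vecI)
          fix i assume "i < dim_vec ((- s j) \<cdot>\<^sub>v v)"
          then have "i < n" using v(1) by simp
          then show "(\<sigma> x *\<^sub>v v) $ i = ((- s j) \<cdot>\<^sub>v v) $ i"
            using arg_cong[OF u0, of "\<lambda>z. z $ i"] w v(1)
            by (simp add: add_eq_0_iff2 del: index_mult_mat_vec)
        qed (use c[OF x_closed] v(1) in auto)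
        have jk: "j + k \<in> {1..2*k}" using j by auto
        have "equiv_rep E \<sigma> (R (j + k))"
          using j(1) R(1)[OF jk] R(2)[OF jk] R(3)[OF jk] xv j(2)
          by (intro irrep_equiv_rep1[OF \<sigma> v ev, of "- s j"]) (auto simp: t_def p'_def)
        then show ?thesis using jk \<rho>R[OF jk] by (intro bexI[of _ "j + k"]) auto
      qed
    next
      case False
      then obtain j where j: "j \<in> {1..2*m}" "\<forall>a\<in>carrier A. \<chi> a = q j a" using q(4)[OF \<chi>] by blast
      have S_complete: "\<exists>i\<in>{1..2 * k + m}. equiv_rep E \<sigma> (\<rho> i)"
        if i: "i \<in> {1..m}" and u: "u \<in> carrier_vec n" "u \<noteq> 0\<^sub>v n"
          and eu: "\<And>a. a \<in> carrier A \<Longrightarrow> \<sigma> (\<iota> a) *\<^sub>v u = q i a \<cdot>\<^sub>v u" for i u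
        using irrep_equiv_rep2[OF \<sigma> u eu S_irrep[OF i] S(2)[OF i] S(3)[OF i]] \<rho>S[OF i] i
        by (intro bexI[of _ "2 * k + i"]) auto
      show ?thesis
      proof (cases "j \<le> m")
        case True
        then show ?thesis using S_complete[OF _ v, of j] ev j by auto
      next
        \<comment> \<open>Here \<open>\<chi>\<close> lies in the second half of the list, so
          \<open>\<chi> \<circ> f\<close> lies in the first, and \<open>x v\<close> takes the place
          of \<open>v\<close>. It is nonzero because \<open>x\<close> sends it to a nonzero multiple
          of \<open>v\<close>.\<close>
        case False
        then have jm: "j - m \<in> {1..m}" using j(1) by auto
        have "\<chi> (f a) = q (j - m) a" if "a \<in> carrier A" for a
          using j(2) q(5)[OF jm, of "f a"] that False by (simp add: f_f)
        moreover have "?w \<noteq> 0\<^sub>v n"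
        proof
          assume "?w = 0\<^sub>v n"
          then have "\<chi> y \<cdot>\<^sub>v v = 0\<^sub>v n" using xw mult_mat_zero_vec[OF c[OF x_closed]] by simp
          then have "(\<chi> y \<cdot>\<^sub>v v) $ i = 0" if "i < n" for i using that by simp
          then have "v = 0\<^sub>v n"
            using is_char_nonzero[OF \<chi> y_closed] v(1) by (intro eq_vecI) auto
          with v show False by simp
        qed
        ultimately show ?thesis using S_complete[OF jm w] evx by simp
      qed
    qed
  qed
  have "enumerates_reps E (irreps E) (2 * k + m) \<rho>"
    unfolding enumerates_reps_def
  proof (intro conjI ballI impI)
    show "\<rho> i \<in> irreps E" if "i \<in> {1..2 * k + m}" for i
      using index_cases[OF that]
    proof (elim disjE bexE)
      assume "i \<in> {1..2*k}"
      then show ?thesis using E.is_rep_1_irrep[OF R(1)] \<rho>R unfolding irreps_def by auto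
    next
      fix j assume "j \<in> {1..m}" "i = 2 * k + j"
      then show ?thesis using S_irrep[of j] \<rho>S[of j] unfolding irreps_def by auto
    qed
    show "\<not> equiv_rep E (\<rho> i) (\<rho> j)" if "i \<in> {1..2 * k + m}" "j \<in> {1..2 * k + m}" "i \<noteq> j" for i j
      using index_cases[OF that(1)] index_cases[OF that(2)] that(3)
      by (elim disjE bexE) (simp_all add: \<rho>R \<rho>S R_inj S_inj RS)
  qed (rule complete)
  moreover have "is_rep E 1 (\<rho> j) \<and> is_rep E 1 (\<rho> (j + k)) \<and>
       \<rho> j x = mat1 (s j) \<and> \<rho> (j + k) x = mat1 (- s j) \<and>
       (\<forall>a\<in>carrier A. \<rho> j (\<iota> a) = mat1 (p j a) \<and> \<rho> (j + k) (\<iota> a) = mat1 (p j a))"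
    if "j \<in> {1..k}" for j
  proof -
    have "j \<in> {1..2*k}" "j + k \<in> {1..2*k}" using that by auto
    then show ?thesis using that R(1)[of j] R(1)[of "j + k"] by (simp add: \<rho>R R t_def p'_def)
  qed
  moreover have "\<rho> (2 * k + j) (\<iota> a) = mat2 (q j a) 0 0 (q j (f a)) \<and>
       \<rho> (2 * k + j) (x \<otimes>\<^bsub>E\<^esub> \<iota> a) = mat2 0 (q j (y \<otimes> f a)) (q j a) 0"
    if "j \<in> {1..m}" "a \<in> carrier A" for j a
    using that E.is_rep_mult[OF S(1)[OF that(1)] x_closed \<iota>_closed[OF that(2)]]
    by (simp add: \<rho>S S mat2_mult is_char_mult[OF qm])
  ultimately show ?thesis by blast
qed

text \<open>Passage from matrix-valued enumerations to scalars. In dimension one equivalence is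
  equality on the carrier, so inequivalence becomes distinctness of the lists and completeness
  becomes exhaustion; triviality on \<open>B\<close> becomes invariance under
  \<open>f\<close>.\<close>

lemma reps_of_enumerations:
  fixes \<pi> :: "nat \<Rightarrow> 'a set \<Rightarrow> complex mat" and \<psi> :: "nat \<Rightarrow> 'a \<Rightarrow> complex mat"
  assumes \<pi>: "enumerates_reps (A Mod B) (irreps (A Mod B)) k \<pi>"
    and s: "\<And>j. j \<in> {1..k} \<Longrightarrow> (s j)\<^sup>2 = entry1 (\<pi> j (B #> y))"
    and \<psi>: "enumerates_reps A (irreps_ker_not_containing A B) (2 * m) \<psi>"
    and \<psi>f: "\<And>j a. j \<in> {1..m} \<Longrightarrow> a \<in> carrier A \<Longrightarrow> \<psi> (j + m) a = \<psi> j (f a)"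
  shows "\<exists>\<rho>. enumerates_reps E (irreps E) (2 * k + m) \<rho> \<and>
    (\<forall>j\<in>{1..k}. is_rep E 1 (\<rho> j) \<and> is_rep E 1 (\<rho> (j + k)) \<and>
       \<rho> j x = mat1 (s j) \<and> \<rho> (j + k) x = mat1 (- s j) \<and>
       (\<forall>a\<in>carrier A. \<rho> j (\<iota> a) = mat1 (entry1 (\<pi> j (B #> a))) \<and>
          \<rho> (j + k) (\<iota> a) = mat1 (entry1 (\<pi> j (B #> a))))) \<and>
    (\<forall>j\<in>{1..m}. \<forall>a\<in>carrier A.
       \<rho> (2 * k + j) (\<iota> a) = mat2 (entry1 (\<psi> j a)) 0 0 (entry1 (\<psi> j (f a))) \<and>
       \<rho> (2 * k + j) (x \<otimes>\<^bsub>E\<^esub> \<iota> a) = mat2 0 (entry1 (\<psi> j (y \<otimes> f a))) (entry1 (\<psi> j a)) 0)"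
proof (rule classification)
  have \<pi>1: "is_rep (A Mod B) 1 (\<pi> j)" if "j \<in> {1..k}" for j
    using \<pi> that by (simp add: enumerates_reps_def Q.irreps_eq[OF finite_Q])
  have \<psi>1: "is_rep A 1 (\<psi> j)" "\<exists>b\<in>B. entry1 (\<psi> j b) \<noteq> 1" if "j \<in> {1..2 * m}" for j
    using \<psi> that by (simp_all add: enumerates_reps_def irreps_ker_not_containing_eq[OF fin B_subset])
  show p: "is_char A (\<lambda>a. entry1 (\<pi> j (B #> a)))" if "j \<in> {1..k}" for j
    using is_char_coset[OF Q.is_rep_1_char[OF \<pi>1[OF that]]] .
  show "entry1 (\<pi> j (B #> f a)) = entry1 (\<pi> j (B #> a))" if j: "j \<in> {1..k}" and a: "a \<in> carrier A" for j a
  proof -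
    have "\<forall>b\<in>B. entry1 (\<pi> j (B #> b)) = 1"
      using is_char_one[OF p[OF j]] coset_of_B by simp
    then show ?thesis using char_trivial_on_B_iff[OF p[OF j]] a by simp
  qed
  show "i = j" if i: "i \<in> {1..k}" and j: "j \<in> {1..k}"
    and eq: "\<forall>a\<in>carrier A. entry1 (\<pi> i (B #> a)) = entry1 (\<pi> j (B #> a))" for i j
  proof (rule ccontr)
    assume "i \<noteq> j"
    then have "\<not> equiv_rep (A Mod B) (\<pi> i) (\<pi> j)" using \<pi> i j by (simp add: enumerates_reps_def)
    moreover have "\<pi> j C = \<pi> i C" if C: "C \<in> carrier (A Mod B)" for C
    proof -
      have "entry1 (\<pi> j C) = entry1 (\<pi> i C)" using C eq by (auto elim!: coset_cases)
      then show ?thesis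
        using mat1_entry1[OF Q.is_rep_carrier[OF \<pi>1[OF i] C]] mat1_entry1[OF Q.is_rep_carrier[OF \<pi>1[OF j] C]]
        by simp
    qed
    ultimately show False using Q.equiv_rep_1_iff[OF \<pi>1[OF i]] \<pi>1[OF j] by blast
  qed
  show "\<exists>j\<in>{1..k}. \<forall>a\<in>carrier A. \<chi> a = entry1 (\<pi> j (B #> a))"
    if \<chi>: "is_char A \<chi>" "\<forall>a\<in>carrier A. \<chi> (f a) = \<chi> a" for \<chi>
  proof -
    from char_factors[OF \<chi>(1)] char_trivial_on_B_iff[OF \<chi>(1)] \<chi>(2)
    obtain \<chi>' where \<chi>': "is_char (A Mod B) \<chi>'" "\<forall>a\<in>carrier A. \<chi>' (B #> a) = \<chi> a" by blast
    have r: "is_rep (A Mod B) 1 (\<lambda>C. mat1 (\<chi>' C))" by (rule Q.is_rep_mat1[OF \<chi>'(1)])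
    then obtain j where j: "j \<in> {1..k}" "equiv_rep (A Mod B) (\<lambda>C. mat1 (\<chi>' C)) (\<pi> j)"
      using \<pi> unfolding enumerates_reps_def Q.irreps_eq[OF finite_Q] by blast
    then have "\<pi> j C = mat1 (\<chi>' C)" if "C \<in> carrier (A Mod B)" for C
      using Q.equiv_rep_1_iff[OF r] that by blast
    then have "\<forall>a\<in>carrier A. \<chi> a = entry1 (\<pi> j (B #> a))"
      using \<chi>'(2) coset_closed by simp
    then show ?thesis using j(1) by blast
  qed
  show "(s j)\<^sup>2 = entry1 (\<pi> j (B #> y))" if "j \<in> {1..k}" for j using s that .
  show q: "is_char A (\<lambda>a. entry1 (\<psi> j a))" if "j \<in> {1..2 * m}" for j
    using is_rep_1_char[OF \<psi>1(1)[OF that]] .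
  show "\<exists>a\<in>carrier A. entry1 (\<psi> j (f a)) \<noteq> entry1 (\<psi> j a)" if j: "j \<in> {1..2 * m}" for j
    using char_trivial_on_B_iff[OF q[OF j]] \<psi>1(2)[OF j] by blast
  show "i = j" if i: "i \<in> {1..2 * m}" and j: "j \<in> {1..2 * m}"
    and eq: "\<forall>a\<in>carrier A. entry1 (\<psi> i a) = entry1 (\<psi> j a)" for i j
  proof (rule ccontr)
    assume "i \<noteq> j"
    then have "\<not> equiv_rep A (\<psi> i) (\<psi> j)" using \<psi> i j by (simp add: enumerates_reps_def)
    moreover have "\<psi> j a = \<psi> i a" if a: "a \<in> carrier A" for a
      using mat1_entry1[OF is_rep_carrier[OF \<psi>1(1)[OF i] a]]
        mat1_entry1[OF is_rep_carrier[OF \<psi>1(1)[OF j] a]] eq a by metis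
    ultimately show False using equiv_rep_1_iff[OF \<psi>1(1)[OF i]] \<psi>1(1)[OF j] by blast
  qed
  show "\<exists>j\<in>{1..2 * m}. \<forall>a\<in>carrier A. \<chi> a = entry1 (\<psi> j a)"
    if \<chi>: "is_char A \<chi>" "\<exists>a\<in>carrier A. \<chi> (f a) \<noteq> \<chi> a" for \<chi>
  proof -
    have r: "is_rep A 1 (\<lambda>a. mat1 (\<chi> a))" by (rule is_rep_mat1[OF \<chi>(1)])
    moreover have "\<exists>b\<in>B. \<chi> b \<noteq> 1" using char_trivial_on_B_iff[OF \<chi>(1)] \<chi>(2) by blast
    ultimately have "(\<lambda>a. mat1 (\<chi> a)) \<in> irreps_ker_not_containing A B"
      by (simp add: irreps_ker_not_containing_eq[OF fin B_subset])
    then obtain j where "j \<in> {1..2 * m}" "equiv_rep A (\<lambda>a. mat1 (\<chi> a)) (\<psi> j)"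
      using \<psi> unfolding enumerates_reps_def by blast
    then show ?thesis using equiv_rep_1_iff[OF r] by (metis entry1_mat1)
  qed
  show "entry1 (\<psi> (j + m) a) = entry1 (\<psi> j (f a))" if "j \<in> {1..m}" "a \<in> carrier A" for j a
    using \<psi>f that by simp
qed

end

text \<open>Composition in \<open>AutoGroup\<close> is restricted to the carrier, so the involution
  property is read off there only.\<close>

lemma AutoGroup_ord_2:
  assumes "group A" "f \<in> carrier (AutoGroup A)" "group.ord (AutoGroup A) f = 2"
  shows "f \<in> hom A A" and "a \<in> carrier A \<Longrightarrow> f (f a) = a"
proof -
  interpret AG: group "AutoGroup A" using assms(1) by (rule group.AutoGroup)
  have f: "f \<in> auto A" using assms(2) by (simp add: AutoGroup_def)
  then show "f \<in> hom A A" by (simp add: auto_def)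
  have "f [^]\<^bsub>AutoGroup A\<^esub> (2::nat) = \<one>\<^bsub>AutoGroup A\<^esub>"
    using AG.pow_ord_eq_1[OF assms(2)] assms(3) by simp
  then have "f \<otimes>\<^bsub>AutoGroup A\<^esub> f = \<one>\<^bsub>AutoGroup A\<^esub>"
    using assms(2) by (simp add: numeral_2_eq_2)
  then have "compose (carrier A) f f = (\<lambda>a\<in>carrier A. a)"
    using f by (simp add: AutoGroup_def BijGroup_def auto_def)
  then show "f (f a) = a" if "a \<in> carrier A"
    using that by (metis compose_eq restrict_apply')
qed

theorem theorem3p4:
  fixes A :: "('a, 'm) monoid_scheme" and f :: "'a \<Rightarrow> 'a" and y :: 'a
    and G :: "'a ext_letter gword set monoid"
    and \<iota> :: "'a \<Rightarrow> 'a ext_letter gword set" and x :: "'a ext_letter gword set"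
    and B :: "'a set" and k m :: nat
  assumes "comm_group A" and "finite (carrier A)" and "card (carrier A) \<ge> 3"
    and "f \<in> carrier (AutoGroup A)" and "group.ord (AutoGroup A) f = 2"
    and "y \<in> carrier A" and "f y = y"
    and G_def: "G = ext_group A f y"
    and \<iota>_def: "\<iota> = ext_base A f y"
    and x_def: "x = ext_elem A f y"
    and B_def: "B = {f a \<otimes>\<^bsub>A\<^esub> inv\<^bsub>A\<^esub> a | a. a \<in> carrier A}"
    and k_def: "k = card (rcosets\<^bsub>A\<^esub> B)"
    and m_def: "m = (card (carrier A) - k) div 2"
  shows "even (card (carrier A) - k)
    \<and> (\<exists>\<rho>. enumerates_reps G (irreps G) (2 * k + m) \<rho>)
    \<and> (\<exists>\<pi>. enumerates_reps (A Mod B) (irreps (A Mod B)) k \<pi>)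
    \<and> (\<exists>\<psi>. enumerates_reps A (irreps_ker_not_containing A B) (card (carrier A) - k) \<psi> \<and>
           (\<forall>j\<in>{1..m}. \<forall>a\<in>carrier A. \<psi> (j + m) a = \<psi> j (f a)))
    \<and> (\<forall>\<pi> s \<psi>.
         enumerates_reps (A Mod B) (irreps (A Mod B)) k \<pi> \<longrightarrow>
         (\<forall>j\<in>{1..k}. (s j)\<^sup>2 = entry1 (\<pi> j (B #>\<^bsub>A\<^esub> y))) \<longrightarrow>
         enumerates_reps A (irreps_ker_not_containing A B) (card (carrier A) - k) \<psi> \<longrightarrow>
         (\<forall>j\<in>{1..m}. \<forall>a\<in>carrier A. \<psi> (j + m) a = \<psi> j (f a)) \<longrightarrow>
         (\<exists>\<rho>. enumerates_reps G (irreps G) (2 * k + m) \<rho> \<and>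
            (\<forall>j\<in>{1..k}.
               is_rep G 1 (\<rho> j) \<and> is_rep G 1 (\<rho> (j + k)) \<and>
               \<rho> j x = mat1 (s j) \<and> \<rho> (j + k) x = mat1 (- s j) \<and>
               (\<forall>a\<in>carrier A.
                  \<rho> j (\<iota> a) = mat1 (entry1 (\<pi> j (B #>\<^bsub>A\<^esub> a))) \<and>
                  \<rho> (j + k) (\<iota> a) = mat1 (entry1 (\<pi> j (B #>\<^bsub>A\<^esub> a))))) \<and>
            (\<forall>j\<in>{1..m}. \<forall>a\<in>carrier A.
               \<rho> (2 * k + j) (\<iota> a) =
                 mat_of_rows_list 2 [[entry1 (\<psi> j a), 0], [0, entry1 (\<psi> j (f a))]] \<and>
               \<rho> (2 * k + j) (x \<otimes>\<^bsub>G\<^esub> \<iota> a) =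
                 mat_of_rows_list 2 [[0, entry1 (\<psi> j (y \<otimes>\<^bsub>A\<^esub> f a))], [entry1 (\<psi> j a), 0]])))"
proof -
  interpret comm_group A by fact
  interpret X: involutive_extension A f y
    using assms(2,6,7) AutoGroup_ord_2[OF is_group assms(4,5)] by unfold_locales auto
  have B: "B = X.B" by (simp add: B_def X.B_def)
  have k: "k = Coset.order (A Mod X.B)" by (simp add: k_def B Coset.order_def FactGroup_def)
  have even: "even (card (carrier A) - k)" unfolding k by (rule X.nontrivial_chars_enumeration(1))
  \<comment> \<open>By evenness the natural-number division by 2 loses nothing.\<close>
  then have m: "card (carrier A) - k = 2 * m" by (simp add: m_def)
  have \<pi>_ex: "\<exists>\<pi>. enumerates_reps (A Mod B) (irreps (A Mod B)) k \<pi>"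
    unfolding B k by (rule X.Q.enumerates_irreps_exists[OF X.finite_Q])
  have \<psi>_ex: "\<exists>\<psi>. enumerates_reps A (irreps_ker_not_containing A B) (card (carrier A) - k) \<psi> \<and>
           (\<forall>j\<in>{1..m}. \<forall>a\<in>carrier A. \<psi> (j + m) a = \<psi> j (f a))"
    unfolding m_def B k by (rule X.nontrivial_chars_enumeration(2))
  note main = X.reps_of_enumerations[folded B G_def \<iota>_def x_def, of k _ _ m]
  from \<pi>_ex \<psi>_ex obtain \<pi> \<psi> where *: "enumerates_reps (A Mod B) (irreps (A Mod B)) k \<pi>"
    "enumerates_reps A (irreps_ker_not_containing A B) (2 * m) \<psi>"
    "\<forall>j\<in>{1..m}. \<forall>a\<in>carrier A. \<psi> (j + m) a = \<psi> j (f a)" unfolding m by blast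
  \<comment> \<open>For bare existence any square roots serve; the principal ones are taken.\<close>
  have "\<exists>\<rho>. enumerates_reps G (irreps G) (2 * k + m) \<rho>"
    using main[OF *(1) _ *(2), of "\<lambda>j. csqrt (entry1 (\<pi> j (B #>\<^bsub>A\<^esub> y)))"] *(3) by auto
  then show ?thesis
  proof (intro conjI even \<pi>_ex \<psi>_ex allI impI, goal_cases)
    case (2 \<pi> s \<psi>)
    then show ?case by (intro main) (simp_all add: m)
  qed
qed

end
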